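(* Let $X$ be a metrizable space. Then $X$ is finite-dimensional and compact if and only if the set of all doubling metrics in $\mathrm{Met}(X)$ is a dense $F_{\sigma}$ subset of $(\mathrm{Met}(X), \mathcal{D}_X)$.
   Context: For a metrizable space $X$, $\mathrm{Met}(X)$ denotes the set of all metrics on $X$ generating the given topology of $X$. The function $\mathcal{D}_X:\mathrm{Met}(X)^2\to[0,\infty]$ is $\mathcal{D}_X(d,e)=\sup_{x,y\in X}|d(x,y)-e(x,y)|$; it is a (possibly $\infty$-valued) metric on $\mathrm{Met}(X)$, and $\mathrm{Met}(X)$ carries the topology it induces. "Finite-dimensional" means finite covering dimension. For a metric space $(X,d)$ and $A\subseteq X$, $\delta_d(A)$ is the diameter of $A$ and $\alpha_d(A)=\inf\{d(x,y): x\neq y,\ x,y\in A\}$. A metric space $(X,d)$ is doubling if there exist $\beta\in(0,\infty)$ and $C\in[1,\infty)$ such that every finite subset $A\subseteq X$ with at least two points satisfies $\mathrm{card}(A)\le C(\delta_d(A)/\alpha_d(A))^{\beta}$. A subset is $F_\sigma$ if it is a countable union of closed sets. *)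

theory Defs
  imports "HOL-Analysis.Analysis"
begin

text \<open>Met(X): metrics on the carrier of X generating the topology of X.
  Metrics are functions on the whole type; to represent each metric uniquely
  we require them to vanish outside the carrier.\<close>
definition met_space :: "'a topology \<Rightarrow> ('a \<Rightarrow> 'a \<Rightarrow> real) set" where
  "met_space X = {d. Metric_space (topspace X) d
                    \<and> Metric_space.mtopology (topspace X) d = X
                    \<and> (\<forall>x y. x \<notin> topspace X \<or> y \<notin> topspace X \<longrightarrow> d x y = 0)}"

definition metD :: "'a topology \<Rightarrow> ('a \<Rightarrow> 'a \<Rightarrow> real) \<Rightarrow> ('a \<Rightarrow> 'a \<Rightarrow> real) \<Rightarrow> ereal" where
  "metD X d e = (SUP p \<in> topspace X \<times> topspace X. ereal \<bar>d (fst p) (snd p) - e (fst p) (snd p)\<bar>)"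

definition met_open :: "'a topology \<Rightarrow> ('a \<Rightarrow> 'a \<Rightarrow> real) set \<Rightarrow> bool" where
  "met_open X U \<longleftrightarrow> U \<subseteq> met_space X \<and>
     (\<forall>d\<in>U. \<exists>\<epsilon>>0. \<forall>e\<in>met_space X. metD X d e < ereal \<epsilon> \<longrightarrow> e \<in> U)"

lemma met_openD:
  assumes "met_open X U" "d \<in> U"
  obtains \<epsilon> where "\<epsilon> > 0" "\<And>e. e \<in> met_space X \<Longrightarrow> metD X d e < ereal \<epsilon> \<Longrightarrow> e \<in> U"
  using assms unfolding met_open_def by blast

lemma met_open_Int:
  assumes S: "met_open X S" and T: "met_open X T"
  shows "met_open X (S \<inter> T)"
  unfolding met_open_def
proof (intro conjI ballI)
  show "S \<inter> T \<subseteq> met_space X" using S unfolding met_open_def by blast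
next
  fix d assume d: "d \<in> S \<inter> T"
  obtain a where a: "a > 0" "\<And>e. e \<in> met_space X \<Longrightarrow> metD X d e < ereal a \<Longrightarrow> e \<in> S"
    using met_openD[OF S] d by blast
  obtain b where b: "b > 0" "\<And>e. e \<in> met_space X \<Longrightarrow> metD X d e < ereal b \<Longrightarrow> e \<in> T"
    using met_openD[OF T] d by blast
  show "\<exists>\<epsilon>>0. \<forall>e\<in>met_space X. metD X d e < ereal \<epsilon> \<longrightarrow> e \<in> S \<inter> T"
  proof (intro exI conjI ballI impI)
    show "min a b > 0" using a b by simp
  next
    fix e assume e: "e \<in> met_space X" "metD X d e < ereal (min a b)"
    have "metD X d e < ereal a"
      using e(2) less_le_trans[of "metD X d e" "ereal (min a b)" "ereal a"] by simp
    moreover have "metD X d e < ereal b"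
      using e(2) less_le_trans[of "metD X d e" "ereal (min a b)" "ereal b"] by simp
    ultimately show "e \<in> S \<inter> T" using a(2) b(2) e(1) by blast
  qed
qed

lemma met_open_Union:
  assumes K: "\<And>k. k \<in> K \<Longrightarrow> met_open X k"
  shows "met_open X (\<Union>K)"
  unfolding met_open_def
proof (intro conjI ballI)
  show "\<Union>K \<subseteq> met_space X" using K unfolding met_open_def by blast
next
  fix d assume "d \<in> \<Union>K"
  then obtain k where k: "k \<in> K" "d \<in> k" by blast
  obtain \<epsilon> where "\<epsilon> > 0" "\<And>e. e \<in> met_space X \<Longrightarrow> metD X d e < ereal \<epsilon> \<Longrightarrow> e \<in> k"
    using met_openD[OF K[OF k(1)] k(2)] by blast
  then show "\<exists>\<epsilon>>0. \<forall>e\<in>met_space X. metD X d e < ereal \<epsilon> \<longrightarrow> e \<in> \<Union>K"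
    using k(1) by blast
qed

lemma istopology_met_open: "istopology (met_open X)"
  unfolding istopology_def using met_open_Int met_open_Union by blast

definition met_topology :: "'a topology \<Rightarrow> ('a \<Rightarrow> 'a \<Rightarrow> real) topology" where
  "met_topology X = topology (met_open X)"

lemma openin_met_topology: "openin (met_topology X) U \<longleftrightarrow> met_open X U"
  by (simp add: met_topology_def istopology_met_open)

lemma topspace_met_topology: "topspace (met_topology X) = met_space X"
proof
  show "topspace (met_topology X) \<subseteq> met_space X"
    unfolding topspace_def openin_met_topology met_open_def by blast
next
  have "met_open X (met_space X)" unfolding met_open_def by (auto intro: exI[of _ 1])
  then show "met_space X \<subseteq> topspace (met_topology X)"
    unfolding topspace_def openin_met_topology by blast
qed

definition diam_set :: "('a \<Rightarrow> 'a \<Rightarrow> real) \<Rightarrow> 'a set \<Rightarrow> real" where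
  "diam_set d A = Sup {d x y | x y. x \<in> A \<and> y \<in> A}"

definition sep_set :: "('a \<Rightarrow> 'a \<Rightarrow> real) \<Rightarrow> 'a set \<Rightarrow> real" where
  "sep_set d A = Inf {d x y | x y. x \<in> A \<and> y \<in> A \<and> x \<noteq> y}"

definition doubling :: "'a set \<Rightarrow> ('a \<Rightarrow> 'a \<Rightarrow> real) \<Rightarrow> bool" where
  "doubling M d \<longleftrightarrow> (\<exists>\<beta>>0. \<exists>C\<ge>1. \<forall>A. A \<subseteq> M \<and> finite A \<and> card A \<ge> 2 \<longrightarrow>
       real (card A) \<le> C * (diam_set d A / sep_set d A) powr \<beta>)"

definition doubling_metrics :: "'a topology \<Rightarrow> ('a \<Rightarrow> 'a \<Rightarrow> real) set" where
  "doubling_metrics X = {d \<in> met_space X. doubling (topspace X) d}"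

definition covering_dim_le :: "'a topology \<Rightarrow> nat \<Rightarrow> bool" where
  "covering_dim_le X n \<longleftrightarrow>
     (\<forall>\<U>. finite \<U> \<and> (\<forall>U\<in>\<U>. openin X U) \<and> \<Union>\<U> = topspace X \<longrightarrow>
        (\<exists>\<V>. (\<forall>V\<in>\<V>. openin X V) \<and> \<Union>\<V> = topspace X \<and> (\<forall>V\<in>\<V>. \<exists>U\<in>\<U>. V \<subseteq> U) \<and>
             (\<forall>x\<in>topspace X. finite {V\<in>\<V>. x \<in> V} \<and> card {V\<in>\<V>. x \<in> V} \<le> n + 1)))"

definition finite_dimensional :: "'a topology \<Rightarrow> bool" where
  "finite_dimensional X \<longleftrightarrow> (\<exists>n. covering_dim_le X n)"

end

theory Submission
  imports Defs
begin

text \<open>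
  If \<open>X\<close> is not compact, a continuous function taking distinct integer values on an infinite closed
  discrete set yields a bounded metric with an infinite separated set, and no metric near it is
  doubling. If \<open>X\<close> is compact with a doubling metric, balls around maximal separated sets form
  arbitrarily fine covers of uniformly bounded multiplicity, so \<open>X\<close> is finite-dimensional.

  Conversely, let \<open>X\<close> be compact of dimension at most \<open>n\<close>. The sup distance of finitely many real
  functions is always doubling. Taking the distances to the points of a fine finite net as coordinates
  approximates a given metric uniformly, and adding a small multiple of finitely many functions that
  separate points makes the result a metric for \<open>X\<close>. Such functions exist because every cover
  can be refined by \<open>2 n + 3\<close> disjoint closed families such that any two points are covered by a
  common family: perturbing the \<open>i\<close>-th function to take distinct constants on the members of the
  \<open>i\<close>-th family separates points at a given scale, and one passes to the limit over all scales.
\<close>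

section \<open>Balls and density for the sup distance on metrics\<close>

text \<open>A strict pointwise bound does not bound the supremum strictly, hence the intermediate
  \<open>t\<close>. Its sign is left free: over an empty carrier the supremum is
  -\<infinity>.\<close>

lemma metD_less_iff:
  "metD X d e < ereal \<epsilon> \<longleftrightarrow>
     (\<exists>t<\<epsilon>. \<forall>x\<in>topspace X. \<forall>y\<in>topspace X. \<bar>d x y - e x y\<bar> \<le> t)"
proof
  assume "metD X d e < ereal \<epsilon>"
  then obtain t where t: "metD X d e < ereal t" "ereal t < ereal \<epsilon>"
    using ereal_dense2 by blast
  have "\<bar>d x y - e x y\<bar> \<le> t" if "x \<in> topspace X" "y \<in> topspace X" for x y
  proof -
    have "ereal \<bar>d x y - e x y\<bar> \<le> metD X d e"
      unfolding metD_def using that by (intro SUP_upper2[of "(x,y)"]) auto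
    then show ?thesis using t(1) by (metis ereal_less_eq(3) less_imp_le order_trans)
  qed
  then show "\<exists>t<\<epsilon>. \<forall>x\<in>topspace X. \<forall>y\<in>topspace X. \<bar>d x y - e x y\<bar> \<le> t"
    using t(2) by auto
next
  assume "\<exists>t<\<epsilon>. \<forall>x\<in>topspace X. \<forall>y\<in>topspace X. \<bar>d x y - e x y\<bar> \<le> t"
  then obtain t where t: "t < \<epsilon>" "\<And>x y. x \<in> topspace X \<Longrightarrow> y \<in> topspace X \<Longrightarrow> \<bar>d x y - e x y\<bar> \<le> t"
    by auto
  have "metD X d e \<le> ereal t"
    unfolding metD_def by (intro SUP_least) (auto intro: t(2))
  then show "metD X d e < ereal \<epsilon>" using t(1) by (simp add: le_less_trans)
qed

lemma metD_lessD:
  "\<lbrakk>metD X d e < ereal \<epsilon>; x \<in> topspace X; y \<in> topspace X\<rbrakk> \<Longrightarrow> \<bar>d x y - e x y\<bar> < \<epsilon>"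
  by (auto simp: metD_less_iff intro: le_less_trans)

lemma met_open_metD_ball: "met_open X {e \<in> met_space X. metD X d e < ereal \<epsilon>}"
  unfolding met_open_def
proof (intro conjI ballI)
  fix e assume "e \<in> {e \<in> met_space X. metD X d e < ereal \<epsilon>}"
  then obtain t where t: "t < \<epsilon>" "\<And>x y. x \<in> topspace X \<Longrightarrow> y \<in> topspace X \<Longrightarrow> \<bar>d x y - e x y\<bar> \<le> t"
    by (auto simp: metD_less_iff)
  show "\<exists>\<delta>>0. \<forall>e'\<in>met_space X. metD X e e' < ereal \<delta> \<longrightarrow> e' \<in> {e \<in> met_space X. metD X d e < ereal \<epsilon>}"
  proof (intro exI[of _ "(\<epsilon> - t)/2"] conjI ballI impI)
    fix e' assume e': "e' \<in> met_space X" "metD X e e' < ereal ((\<epsilon> - t)/2)"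
    have "\<bar>d x y - e' x y\<bar> \<le> t + (\<epsilon> - t)/2" if "x \<in> topspace X" "y \<in> topspace X" for x y
      using t(2)[OF that] metD_lessD[OF e'(2) that] by linarith
    then show "e' \<in> {e \<in> met_space X. metD X d e < ereal \<epsilon>}"
      using e'(1) t(1) by (auto simp: metD_less_iff intro!: exI[of _ "t + (\<epsilon> - t)/2"] simp: field_simps)
  qed (use t in auto)
qed auto

text \<open>Balls are open by \<open>met_open_metD_ball\<close>, and an open set contains a ball
  around each of its points, so closure can be tested on balls.\<close>

lemma metD_dense_iff:
  assumes "S \<subseteq> met_space X"
  shows "(met_topology X) closure_of S = topspace (met_topology X) \<longleftrightarrow>
         (\<forall>d\<in>met_space X. \<forall>\<epsilon>>0. \<exists>e\<in>S. metD X d e < ereal \<epsilon>)" (is "?L = ?R")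
proof
  assume L: ?L
  show ?R
  proof (intro ballI allI impI)
    fix d and \<epsilon> :: real assume d: "d \<in> met_space X" and "\<epsilon> > 0"
    have "d \<in> {e \<in> met_space X. metD X d e < ereal \<epsilon>}"
      using d \<open>\<epsilon> > 0\<close> by (auto simp: metD_less_iff intro!: exI[of _ 0])
    moreover have "openin (met_topology X) {e \<in> met_space X. metD X d e < ereal \<epsilon>}"
      by (simp add: openin_met_topology met_open_metD_ball)
    moreover have "d \<in> (met_topology X) closure_of S" using L d by (simp add: topspace_met_topology)
    ultimately obtain e where "e \<in> S" "e \<in> {e \<in> met_space X. metD X d e < ereal \<epsilon>}"
      by (metis (no_types, lifting) in_closure_of)
    then show "\<exists>e\<in>S. metD X d e < ereal \<epsilon>" by blast
  qed
next
  assume R: ?R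
  have "d \<in> (met_topology X) closure_of S" if d: "d \<in> met_space X" for d
    unfolding in_closure_of openin_met_topology topspace_met_topology
  proof (intro conjI allI impI d)
    fix T assume T: "d \<in> T \<and> met_open X T"
    then obtain \<epsilon> where "\<epsilon> > 0" "\<And>e. e \<in> met_space X \<Longrightarrow> metD X d e < ereal \<epsilon> \<Longrightarrow> e \<in> T"
      using met_openD by metis
    then show "\<exists>y. y \<in> S \<and> y \<in> T" using R d assms by blast
  qed
  then show ?L by (auto simp: topspace_met_topology dest: in_closure_of[THEN iffD1])
qed

section \<open>Diameter, separation and the F_\<sigma> property\<close>

lemma finite_dist_values: "finite A \<Longrightarrow> finite {d x y | x y. x \<in> A \<and> y \<in> A \<and> P x y}"
  by (rule finite_subset[of _ "(\<lambda>(x,y). d x y) ` (A \<times> A)"]) auto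

lemma card_ge_2_distinct:
  assumes "2 \<le> card A"
  obtains x y where "x \<in> A" "y \<in> A" "x \<noteq> y"
  using assms by (metis card_2_iff' obtain_subset_with_card_n subsetD)

lemma diam_set_upper: "\<lbrakk>finite A; x \<in> A; y \<in> A\<rbrakk> \<Longrightarrow> d x y \<le> diam_set d A"
  unfolding diam_set_def using finite_dist_values[of A d "\<lambda>_ _. True"]
  by (intro cSup_upper bdd_above_finite) auto

lemma sep_set_lower: "\<lbrakk>finite A; x \<in> A; y \<in> A; x \<noteq> y\<rbrakk> \<Longrightarrow> sep_set d A \<le> d x y"
  unfolding sep_set_def using finite_dist_values[of A d "(\<noteq>)"]
  by (intro cInf_lower bdd_below_finite) auto

lemma diam_set_least:
  assumes "A \<noteq> {}" "\<And>x y. \<lbrakk>x \<in> A; y \<in> A\<rbrakk> \<Longrightarrow> d x y \<le> c"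
  shows "diam_set d A \<le> c"
  unfolding diam_set_def using assms by (intro cSup_least) blast+

lemma sep_set_greatest:
  assumes "2 \<le> card A" "\<And>x y. \<lbrakk>x \<in> A; y \<in> A; x \<noteq> y\<rbrakk> \<Longrightarrow> c \<le> d x y"
  shows "c \<le> sep_set d A"
proof -
  obtain x y where "x \<in> A" "y \<in> A" "x \<noteq> y" using assms(1) by (rule card_ge_2_distinct)
  then show ?thesis unfolding sep_set_def using assms by (intro cInf_greatest) auto
qed

lemma sep_le_diam:
  assumes "finite A" "2 \<le> card A"
  shows "sep_set d A \<le> diam_set d A"
proof -
  obtain x y where "x \<in> A" "y \<in> A" "x \<noteq> y" using assms(2) by (rule card_ge_2_distinct)
  then show ?thesis using diam_set_upper[of A x y d] sep_set_lower[of A x y d] assms by simp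
qed

text \<open>A finite set attains its separation, so positivity is inherited from a single pair of
  distinct points.\<close>

lemma (in Metric_space) sep_set_pos:
  assumes "finite A" "A \<subseteq> M" "2 \<le> card A"
  shows "0 < sep_set d A"
proof -
  obtain x y where "x \<in> A" "y \<in> A" "x \<noteq> y" using assms(3) by (rule card_ge_2_distinct)
  then have "{d x y | x y. x \<in> A \<and> y \<in> A \<and> x \<noteq> y} \<noteq> {}" by blast
  then have "sep_set d A \<in> {d x y | x y. x \<in> A \<and> y \<in> A \<and> x \<noteq> y}"
    unfolding sep_set_def
    using finite_dist_values[OF assms(1), of d "(\<noteq>)"] by (subst cInf_eq_Min) (assumption | rule Min_in)+
  then show ?thesis using assms(2) by (auto intro!: mdist_pos_less)
qed

text \<open>Bounding both constants by one integer \<open>N\<close> writes the doubling condition as a countable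
  union; each member is closed because diameter and separation of a fixed finite set depend
  continuously on the metric.\<close>

definition N_doubling :: "'a set \<Rightarrow> nat \<Rightarrow> ('a \<Rightarrow> 'a \<Rightarrow> real) \<Rightarrow> bool" where
  "N_doubling M N d \<longleftrightarrow> (\<forall>A. A \<subseteq> M \<and> finite A \<and> card A \<ge> 2 \<longrightarrow>
     real (card A) \<le> real N * (diam_set d A / sep_set d A) ^ N)"

text \<open>The ratio of diameter to separation is at least 1, so replacing both \<open>C\<close>
  and \<open>\<beta>\<close> by one integer above them only weakens the bound.\<close>

lemma doubling_iff_N_doubling:
  assumes "Metric_space M d"
  shows "doubling M d \<longleftrightarrow> (\<exists>N>0. N_doubling M N d)"
proof
  assume "doubling M d"
  then obtain \<beta> C where bC: "\<beta> > 0" "C \<ge> 1"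
    "\<And>A. \<lbrakk>A \<subseteq> M; finite A; card A \<ge> 2\<rbrakk> \<Longrightarrow> real (card A) \<le> C * (diam_set d A / sep_set d A) powr \<beta>"
    unfolding doubling_def by blast
  obtain N :: nat where N: "max \<beta> C \<le> real N" using real_arch_simple by blast
  have "real (card A) \<le> real N * (diam_set d A / sep_set d A) ^ N"
    if A: "A \<subseteq> M" "finite A" "card A \<ge> 2" for A
  proof -
    let ?r = "diam_set d A / sep_set d A"
    have r: "?r \<ge> 1"
      using Metric_space.sep_set_pos[OF assms A(2,1,3)] sep_le_diam[OF A(2,3), of d] by simp
    have "real (card A) \<le> C * ?r powr \<beta>" using bC(3) A by blast
    also have "\<dots> \<le> C * ?r powr real N"
      using N r bC by (intro mult_left_mono powr_mono) auto
    also have "\<dots> \<le> real N * ?r powr real N" using N by (intro mult_right_mono) auto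
    finally show ?thesis using r by (simp add: powr_realpow)
  qed
  moreover have "N > 0" using N bC by (cases N) auto
  ultimately show "\<exists>N>0. N_doubling M N d" unfolding N_doubling_def by blast
next
  assume "\<exists>N>0. N_doubling M N d"
  then obtain N where N: "N > 0" "N_doubling M N d" by blast
  have "real (card A) \<le> real N * (diam_set d A / sep_set d A) powr real N"
    if A: "A \<subseteq> M" "finite A" "card A \<ge> 2" for A
  proof -
    have "diam_set d A / sep_set d A \<ge> 1"
      using Metric_space.sep_set_pos[OF assms A(2,1,3)] sep_le_diam[OF A(2,3), of d] by simp
    then show ?thesis using N(2) A by (simp add: N_doubling_def powr_realpow)
  qed
  then show "doubling M d" unfolding doubling_def using N(1)
    by (intro exI[of _ "real N"] conjI) auto
qed

lemma closedin_N_doubling: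
  "closedin (met_topology X) {d \<in> met_space X. N_doubling (topspace X) N d}" (is "closedin _ ?C")
proof -
  have "met_open X (met_space X - ?C)"
    unfolding met_open_def
  proof (intro conjI ballI)
    fix d assume "d \<in> met_space X - ?C"
    then obtain A where d: "d \<in> met_space X" and A: "A \<subseteq> topspace X" "finite A" "card A \<ge> 2"
      and big: "real N * (diam_set d A / sep_set d A) ^ N < real (card A)"
      unfolding N_doubling_def by (auto simp: not_le)
    let ?D = "diam_set d A" and ?s = "sep_set d A"
    have M: "Metric_space (topspace X) d" using d by (simp add: met_space_def)
    have s: "?s > 0" using Metric_space.sep_set_pos[OF M A(2,1,3)] .
    have D: "?D > 0" using s sep_le_diam[OF A(2,3), of d] by linarith
    \<comment> \<open>A metric within \<open>t\<close> of \<open>d\<close> has diameter at most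
      \<open>?D + t\<close> and separation at least \<open>?s - t\<close> on \<open>A\<close>. The
      violation \<open>big\<close> is strict, so it survives for some small
      \<open>t\<close>.\<close>
    have "((\<lambda>t. real N * ((?D + t) / (?s - t)) ^ N) \<longlongrightarrow> real N * ((?D + 0) / (?s - 0)) ^ N) (at_right 0)"
      using s by (intro tendsto_intros) auto
    then have "\<forall>\<^sub>F t in at_right 0. real N * ((?D + t) / (?s - t)) ^ N < real (card A)"
      using big by (intro order_tendstoD(2)) auto
    moreover have "\<forall>\<^sub>F t in at_right 0. t < ?s \<and> (0::real) < t"
      using eventually_at_right_less[of 0] eventually_at_right_field s by (auto intro!: eventually_conj)
    ultimately have "\<forall>\<^sub>F t in at_right 0. real N * ((?D + t) / (?s - t)) ^ N < real (card A) \<and> t < ?s \<and> 0 < t"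
      by eventually_elim auto
    then obtain t where t: "real N * ((?D + t) / (?s - t)) ^ N < real (card A)" "t < ?s" "0 < t"
      using eventually_happens trivial_limit_at_right_real by blast
    show "\<exists>\<epsilon>>0. \<forall>e\<in>met_space X. metD X d e < ereal \<epsilon> \<longrightarrow> e \<in> met_space X - ?C"
    proof (intro exI[of _ t] conjI ballI impI)
      fix e assume e: "e \<in> met_space X" "metD X d e < ereal t"
      have close: "\<bar>d x y - e x y\<bar> < t" if "x \<in> A" "y \<in> A" for x y
        using metD_lessD[OF e(2)] that A(1) by blast
      have "diam_set e A \<le> ?D + t"
        using A close diam_set_upper[OF A(2), of _ _ d] by (intro diam_set_least) (fastforce+)
      moreover have "?s - t \<le> sep_set e A"
        using A close sep_set_lower[OF A(2), of _ _ d] by (intro sep_set_greatest) (fastforce+)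
      moreover have "0 \<le> diam_set e A"
        using sep_le_diam[OF A(2,3), of e] \<open>?s - t \<le> sep_set e A\<close> t by linarith
      ultimately have "diam_set e A / sep_set e A \<le> (?D + t) / (?s - t)"
        using t D by (intro frac_le) auto
      then have "(diam_set e A / sep_set e A) ^ N \<le> ((?D + t) / (?s - t)) ^ N"
        using \<open>0 \<le> diam_set e A\<close> \<open>?s - t \<le> sep_set e A\<close> t by (intro power_mono divide_nonneg_nonneg) auto
      then have "real N * (diam_set e A / sep_set e A) ^ N \<le> real N * ((?D + t) / (?s - t)) ^ N"
        by (intro mult_left_mono) auto
      then have "real N * (diam_set e A / sep_set e A) ^ N < real (card A)"
        using t(1) by linarith
      then show "e \<in> met_space X - ?C" using e(1) A unfolding N_doubling_def by (auto simp: not_le)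
    qed (use t in auto)
  qed auto
  then show ?thesis by (auto simp: closedin_def topspace_met_topology openin_met_topology)
qed

lemma fsigma_in_doubling_metrics: "fsigma_in (met_topology X) (doubling_metrics X)"
proof -
  have "doubling_metrics X = \<Union> ((\<lambda>N. {d \<in> met_space X. N_doubling (topspace X) N d}) ` {0<..})"
    using doubling_iff_N_doubling by (auto simp: doubling_metrics_def met_space_def)
  then show ?thesis
    by (simp only:) (intro fsigma_in_Union, auto intro!: closed_imp_fsigma_in closedin_N_doubling)
qed

section \<open>Metrics generating a given topology, and noncompact spaces\<close>

text \<open>Each ball of \<open>e\<close> is cut out of \<open>X\<close> by an open condition on
  \<open>e x\<close>. This is one of the two inclusions between the topologies; each application
  proves the other in its own way.\<close>

lemma openin_of_continuous_metric:
  assumes "Metric_space (topspace X) e"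
    and "\<And>x. x \<in> topspace X \<Longrightarrow> continuous_map X euclideanreal (e x)"
    and "openin (Metric_space.mtopology (topspace X) e) U"
  shows "openin X U"
proof -
  interpret Metric_space "topspace X" e by fact
  have "\<exists>T. openin X T \<and> x \<in> T \<and> T \<subseteq> U" if xU: "x \<in> U" for x
  proof -
    have x: "x \<in> topspace X" using assms(3) that by (auto simp: openin_mtopology)
    obtain r where r: "r > 0" "mball x r \<subseteq> U" using assms(3) xU by (meson openin_mtopology)
    have "openin X {y \<in> topspace X. e x y \<in> {..<r}}"
      using assms(2)[OF x] by (rule openin_continuous_map_preimage) auto
    then show ?thesis using r x by (intro exI[of _ "{y \<in> topspace X. e x y \<in> {..<r}}"]) (auto simp: subset_iff)
  qed
  then show ?thesis using openin_subopen by metis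
qed

lemma met_spaceD:
  assumes "d \<in> met_space X"
  shows "Metric_space (topspace X) d" "Metric_space.mtopology (topspace X) d = X"
  using assms by (auto simp: met_space_def)

lemma continuous_map_met_space:
  assumes "d \<in> met_space X" "x \<in> topspace X"
  shows "continuous_map X euclideanreal (d x)"
proof -
  interpret Metric_space "topspace X" d using met_spaceD assms by auto
  have "continuous_map mtopology euclideanreal (d x)"
    using continuous_on_mdist[of x Self] assms(2) by (simp add: mtopology_of_def)
  then show ?thesis using met_spaceD assms by metis
qed

text \<open>A metric given by metrizability is arbitrary outside its carrier, so it is reset to 0
  there, as \<open>met_space\<close> demands; balls do not change.\<close>

lemma met_space_nonempty:
  assumes "metrizable_space X"
  obtains d where "d \<in> met_space X"
proof -
  obtain M d where d: "Metric_space M d" "X = Metric_space.mtopology M d"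
    using assms by (auto simp: metrizable_space_def)
  then have M: "topspace X = M" by (simp add: Metric_space.topspace_mtopology)
  define e where "e = (\<lambda>x y. if x \<in> M \<and> y \<in> M then d x y else 0)"
  have e: "Metric_space M e"
    using d(1) by (auto simp: Metric_space_def e_def)
  have "Metric_space.mball M e x r = Metric_space.mball M d x r" for x r
    using Metric_space.in_mball[OF d(1)] Metric_space.in_mball[OF e] by (auto simp: e_def)
  then have "Metric_space.mtopology M e = Metric_space.mtopology M d"
    by (simp add: topology_eq Metric_space.openin_mtopology[OF e] Metric_space.openin_mtopology[OF d(1)])
  then have "e \<in> met_space X"
    unfolding met_space_def using e d M by (auto simp: e_def)
  then show ?thesis by (rule that)
qed

text \<open>Distinct points of \<open>S\<close> have \<open>e\<close>-distance between 1/2 and 5/2,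
  so every finite subset has ratio at most 5, while its cardinality can be as large as
  desired.\<close>

lemma not_doubling_near:
  assumes "Metric_space (topspace X) e" "infinite S" "S \<subseteq> topspace X"
    and "\<And>x y. \<lbrakk>x \<in> S; y \<in> S; x \<noteq> y\<rbrakk> \<Longrightarrow> 1 \<le> d x y \<and> d x y \<le> 2"
    and "metD X d e < ereal (1/2)"
  shows "\<not> doubling (topspace X) e"
proof
  interpret Metric_space "topspace X" e by fact
  assume "doubling (topspace X) e"
  then obtain N where N: "N > 0" "N_doubling (topspace X) N e"
    using doubling_iff_N_doubling assms(1) by blast
  obtain k :: nat where k: "max 2 (real N * 5 ^ N) < real k" using reals_Archimedean2 by blast
  obtain A where A: "A \<subseteq> S" "finite A" "card A = k" using infinite_arbitrarily_large[OF assms(2)] by blast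
  have 2: "2 \<le> card A" using k A by linarith
  have close: "1/2 \<le> e x y \<and> e x y \<le> 5/2" if "x \<in> A" "y \<in> A" "x \<noteq> y" for x y
    using metD_lessD[OF assms(5), of x y] assms(4)[of x y] that A(1) assms(3)
    by (smt (verit, best) field_sum_of_halves subsetD)
  have "diam_set e A \<le> 5/2"
  proof (rule diam_set_least)
    show "e x y \<le> 5/2" if "x \<in> A" "y \<in> A" for x y
      using close[OF that] that A(1) assms(3) by (cases "x = y") auto
  qed (use 2 in auto)
  moreover have "1/2 \<le> sep_set e A" using 2 close by (intro sep_set_greatest) auto
  ultimately have "diam_set e A / sep_set e A \<le> (5/2)/(1/2)"
    using sep_le_diam[OF A(2) 2, of e] by (intro frac_le) auto
  then have "diam_set e A / sep_set e A \<le> 5" by simp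
  moreover have "0 \<le> diam_set e A / sep_set e A"
    using \<open>1/2 \<le> sep_set e A\<close> sep_le_diam[OF A(2) 2, of e] by (intro divide_nonneg_nonneg) auto
  ultimately have "(diam_set e A / sep_set e A) ^ N \<le> 5 ^ N" by (intro power_mono)
  then have "real N * (diam_set e A / sep_set e A) ^ N \<le> real N * 5 ^ N" by (intro mult_left_mono) auto
  moreover have "real (card A) \<le> real N * (diam_set e A / sep_set e A) ^ N"
    using N(2) A 2 assms(3) unfolding N_doubling_def by blast
  ultimately show False using k A by linarith
qed

lemma noncompact_imp_not_doubling_near:
  assumes "metrizable_space X" "\<not> compact_space X"
  obtains d where "d \<in> met_space X" "\<And>e. \<lbrakk>e \<in> met_space X; metD X d e < ereal (1/2)\<rbrakk> \<Longrightarrow> \<not> doubling (topspace X) e"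
proof -
  obtain d where d: "d \<in> met_space X" using met_space_nonempty[OF assms(1)] .
  note D = met_spaceD[OF d]
  interpret Metric_space "topspace X" d by fact
  \<comment> \<open>By the Bolzano-Weierstrass criterion, failure of compactness gives an infinite
    set without limit points, which is then closed and discrete.\<close>
  obtain S where S: "S \<subseteq> topspace X" "infinite S" "X derived_set_of S = {}"
    using assms(2) compact_space_eq_Bolzano_Weierstrass unfolding D(2) by blast
  have clo: "closedin X S" using S by (simp add: closedin_contains_derived_set)
  have disc: "subtopology X S = discrete_topology S"
    using S by (simp add: subtopology_eq_discrete_topology_gen Int_absorb1)
  obtain T where T: "T \<subseteq> S" "countable T" "infinite T" using infinite_countable_subset'[OF S(2)] by auto
  \<comment> \<open>Discreteness of \<open>S\<close> makes any \<open>h\<close> continuous on it.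
    Only its values on the countable set \<open>T\<close> matter, where \<open>to_nat_on\<close> is
    injective.\<close>
  define h :: "'a \<Rightarrow> real" where "h x = real (to_nat_on T x)" for x
  have "continuous_map (subtopology X S) euclideanreal h" by (simp add: disc)
  then obtain f where f: "continuous_map X euclideanreal f" "\<And>x. x \<in> S \<Longrightarrow> f x = h x"
    using metrizable_imp_normal_space[OF assms(1)] clo by (metis normal_space_iff_Tietze)
  have sep: "1 \<le> \<bar>f x - f y\<bar>" if "x \<in> T" "y \<in> T" "x \<noteq> y" for x y
  proof -
    have "to_nat_on T x \<noteq> to_nat_on T y" using that T by simp
    moreover have "f x = h x" "f y = h y" using that T f by auto
    ultimately show ?thesis by (simp add: h_def)
  qed
  \<comment> \<open>The first summand keeps the topology, the second spreads \<open>T\<close> out;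
    capping both at 1 puts distinct points of \<open>T\<close> at distance between 1 and 2.\<close>
  define e where "e = (\<lambda>x y. if x \<in> topspace X \<and> y \<in> topspace X then min 1 (d x y) + min 1 \<bar>f x - f y\<bar> else 0)"
  have e: "Metric_space (topspace X) e"
  proof
    show "0 \<le> e x y" for x y by (simp add: e_def)
    show "e x y = e y x" for x y by (simp add: e_def commute abs_minus_commute)
    show "e x y = 0 \<longleftrightarrow> x = y" if "x \<in> topspace X" "y \<in> topspace X" for x y
    proof (cases "x = y")
      case False
      then have "0 < min 1 (d x y)" using that mdist_pos_less by simp
      then have "0 < min 1 (d x y) + min 1 \<bar>f x - f y\<bar>" by linarith
      then show ?thesis using False that by (simp add: e_def)
    qed (use that in \<open>simp add: e_def\<close>)
    show "e x z \<le> e x y + e y z" if "x \<in> topspace X" "y \<in> topspace X" "z \<in> topspace X" for x y z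
    proof -
      have min1: "min 1 a \<le> min 1 b + min 1 c" if "a \<le> b + c" "0 \<le> b" "0 \<le> c" for a b c :: real
        using that by linarith
      have "min 1 (d x z) \<le> min 1 (d x y) + min 1 (d y z)"
        using that triangle by (intro min1) auto
      moreover have "min 1 \<bar>f x - f z\<bar> \<le> min 1 \<bar>f x - f y\<bar> + min 1 \<bar>f y - f z\<bar>"
        by (intro min1) auto
      ultimately show ?thesis using that by (simp add: e_def)
    qed
  qed
  have cont: "continuous_map X euclideanreal (e x)" if "x \<in> topspace X" for x
  proof -
    have "continuous_map X euclideanreal (\<lambda>y. min 1 (d x y) + min 1 \<bar>f x - f y\<bar>)"
      using continuous_map_met_space[OF d that] f(1) by (intro continuous_intros) auto
    then show ?thesis by (rule continuous_map_eq) (use that in \<open>simp add: e_def\<close>)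
  qed
  have "openin X U \<longleftrightarrow> openin (Metric_space.mtopology (topspace X) e) U" for U
  proof
    assume U: "openin X U"
    have "\<exists>r>0. Metric_space.mball (topspace X) e x r \<subseteq> U" if x: "x \<in> U" for x
    proof -
      obtain r where r: "r > 0" "mball x r \<subseteq> U"
        using U D(2) openin_mtopology x by metis
      \<comment> \<open>The cap does no harm at radius at most 1:
        \<open>min 1 (d x y) < min 1 r\<close> forces \<open>d x y < r\<close>.\<close>
      have "Metric_space.mball (topspace X) e x (min 1 r) \<subseteq> mball x r"
      proof
        fix y assume "y \<in> Metric_space.mball (topspace X) e x (min 1 r)"
        then have y: "x \<in> topspace X" "y \<in> topspace X" "e x y < min 1 r"
          by (simp_all add: Metric_space.in_mball[OF e])
        moreover have "min 1 (d x y) \<le> e x y" using y by (simp add: e_def)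
        ultimately have "d x y < r" by linarith
        then show "y \<in> mball x r" using y by simp
      qed
      then show ?thesis using r by (intro exI[of _ "min 1 r"]) auto
    qed
    then show "openin (Metric_space.mtopology (topspace X) e) U"
      using openin_subset[OF U] by (simp add: Metric_space.openin_mtopology[OF e])
  qed (rule openin_of_continuous_metric[OF e cont])
  then have "Metric_space.mtopology (topspace X) e = X" by (simp add: topology_eq)
  then have "e \<in> met_space X" using e by (auto simp: met_space_def e_def)
  moreover have "\<not> doubling (topspace X) e'" if "e' \<in> met_space X" "metD X e e' < ereal (1/2)" for e'
  proof (rule not_doubling_near[OF met_spaceD(1)[OF that(1)] T(3) _ _ that(2)])
    show "T \<subseteq> topspace X" using T S by auto
    show "1 \<le> e x y \<and> e x y \<le> 2" if "x \<in> T" "y \<in> T" "x \<noteq> y" for x y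
    proof -
      have "x \<in> topspace X" "y \<in> topspace X" using that T S by auto
      then show ?thesis using sep[OF that] by (auto simp: e_def min_def)
    qed
  qed
  ultimately show ?thesis by (rule that)
qed

section \<open>Compact spaces with a doubling metric are finite-dimensional\<close>

text \<open>Total boundedness limits the size of \<open>r\<close>-separated sets, so one of largest
  cardinality exists; a point at distance at least \<open>r\<close> from all of it could still be
  added.\<close>

lemma (in Metric_space) finite_separated_net:
  assumes "compact_space mtopology" "r > 0"
  obtains A where "finite A" "A \<subseteq> M" "\<And>x y. \<lbrakk>x \<in> A; y \<in> A; x \<noteq> y\<rbrakk> \<Longrightarrow> r \<le> d x y"
    "\<And>x. x \<in> M \<Longrightarrow> \<exists>a\<in>A. d a x < r"
proof -
  have "mtotally_bounded M"
    using assms(1) compactin_imp_mtotally_bounded by (simp add: compact_space_def)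
  then obtain K where K: "finite K" "K \<subseteq> M" "M \<subseteq> (\<Union>x\<in>K. mball x (r/2))"
    using assms(2) unfolding mtotally_bounded_def by (meson half_gt_zero)
  define P where "P A \<longleftrightarrow> A \<subseteq> M \<and> (\<forall>x\<in>A. \<forall>y\<in>A. x \<noteq> y \<longrightarrow> r \<le> d x y)" for A
  have bound: "finite A \<and> card A \<le> card K" if "P A" for A
  proof -
    have "\<exists>k\<in>K. d k x < r/2" if "x \<in> A" for x using K(3) that \<open>P A\<close> by (fastforce simp: P_def)
    then obtain k where k: "\<And>x. x \<in> A \<Longrightarrow> k x \<in> K \<and> d (k x) x < r/2" by metis
    \<comment> \<open>Two points of \<open>A\<close> assigned to the same centre would be at
      distance below \<open>r/2 + r/2\<close>.\<close>
    have "inj_on k A"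
    proof (rule inj_onI, rule ccontr)
      fix x y assume *: "x \<in> A" "y \<in> A" "k x = k y" "x \<noteq> y"
      have "d x y \<le> d (k x) x + d (k x) y"
        using * k[of x] K(2) \<open>P A\<close> by (intro triangle'') (auto simp: P_def)
      then show False using * k[of x] k[of y] \<open>P A\<close> by (fastforce simp: P_def)
    qed
    then show ?thesis using k K(1) by (meson card_inj_on_le image_subsetI inj_on_finite)
  qed
  have "P {}" by (simp add: P_def)
  then obtain A where A: "P A" "\<And>B. P B \<Longrightarrow> card B \<le> card A"
    using ex_has_greatest_nat[of P "{}" card "Suc (card K)"] bound by (metis less_Suc_eq_le)
  show thesis
  proof
    show "finite A" "A \<subseteq> M" "\<And>x y. \<lbrakk>x \<in> A; y \<in> A; x \<noteq> y\<rbrakk> \<Longrightarrow> r \<le> d x y"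
      using A(1) bound by (auto simp: P_def)
    show "\<exists>a\<in>A. d a x < r" if "x \<in> M" for x
    proof (rule ccontr)
      assume neg: "\<not> (\<exists>a\<in>A. d a x < r)"
      then have "x \<notin> A" using that assms(2) by force
      moreover have "P (insert x A)" using neg A(1) that by (auto simp: P_def commute not_less)
      ultimately show False using A(2)[of "insert x A"] bound[OF A(1)] by simp
    qed
  qed
qed

text \<open>With \<open>l\<close> a Lebesgue number, balls of radius \<open>l\<close> around an
  \<open>l/2\<close>-separated net refine the cover. The centres whose balls contain
  \<open>x\<close> are \<open>l/2\<close>-separated and have diameter at most \<open>2 * l\<close>,
  so their ratio is at most 4 and doubling bounds their number independently of the cover.\<close>

lemma (in Metric_space) doubling_compact_imp_finite_dimensional:
  assumes "compact_space mtopology" "doubling M d"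
  shows "finite_dimensional mtopology"
proof -
  obtain N where N: "N > 0" "N_doubling M N d"
    using assms(2) doubling_iff_N_doubling[OF Metric_space_axioms] by blast
  have "covering_dim_le mtopology (N * 4 ^ N)"
    unfolding covering_dim_le_def
  proof (intro allI impI, elim conjE)
    fix \<U> assume U: "finite \<U>" "\<forall>U\<in>\<U>. openin mtopology U" "\<Union>\<U> = topspace mtopology"
    obtain l where l: "l > 0" "\<forall>x\<in>M. \<exists>U\<in>\<U>. mball x l \<subseteq> U"
      using lebesgue_number[of M \<U>] assms(1) U by (auto simp: compact_space_def)
    define r where "r = l / 2"
    have r: "r > 0" using l by (simp add: r_def)
    obtain A where A: "finite A" "A \<subseteq> M" "\<And>x y. \<lbrakk>x \<in> A; y \<in> A; x \<noteq> y\<rbrakk> \<Longrightarrow> r \<le> d x y"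
      "\<And>x. x \<in> M \<Longrightarrow> \<exists>a\<in>A. d a x < r"
      using finite_separated_net[OF assms(1) r] by metis
    define \<V> where "\<V> = (\<lambda>a. mball a l) ` A"
    have "finite {V\<in>\<V>. x \<in> V} \<and> card {V\<in>\<V>. x \<in> V} \<le> N * 4 ^ N + 1" if x: "x \<in> M" for x
    proof -
      define B where "B = {a\<in>A. d a x < l}"
      have B: "finite B" "B \<subseteq> M" using A by (auto simp: B_def)
      have eq: "{V\<in>\<V>. x \<in> V} = (\<lambda>a. mball a l) ` B"
        using A x by (auto simp: \<V>_def B_def)
      have "card B \<le> N * 4 ^ N + 1"
      proof (cases "2 \<le> card B")
        case True
        have s: "r \<le> sep_set d B" using A(3) True by (intro sep_set_greatest) (auto simp: B_def)
        have "diam_set d B \<le> 4 * r"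
        proof (rule diam_set_least)
          fix a b assume ab: "a \<in> B" "b \<in> B"
          then have "d a b \<le> d a x + d b x" using B x by (intro triangle') auto
          then show "d a b \<le> 4 * r" using ab by (auto simp: B_def r_def)
        qed (use True in auto)
        then have "diam_set d B / sep_set d B \<le> (4 * r) / r" using s r by (intro frac_le) auto
        then have "diam_set d B / sep_set d B \<le> 4" using r by simp
        moreover have "0 \<le> diam_set d B / sep_set d B"
          using s r sep_le_diam[OF B(1) True, of d] by (intro divide_nonneg_nonneg) auto
        ultimately have "(diam_set d B / sep_set d B) ^ N \<le> 4 ^ N" by (intro power_mono)
        then have "real N * (diam_set d B / sep_set d B) ^ N \<le> real N * 4 ^ N" by (intro mult_left_mono) auto
        moreover have "real (card B) \<le> real N * (diam_set d B / sep_set d B) ^ N"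
          using N(2) B True unfolding N_doubling_def by blast
        ultimately have "real (card B) \<le> real (N * 4 ^ N)" by simp
        then show ?thesis by linarith
      qed auto
      then show ?thesis unfolding eq using B card_image_le[OF B(1), of "\<lambda>a. mball a l"] by auto
    qed
    moreover have "\<Union>\<V> = M"
    proof
      show "M \<subseteq> \<Union>\<V>" using A(2,4) r by (fastforce simp: \<V>_def r_def)
    qed (auto simp: \<V>_def)
    moreover have "\<forall>V\<in>\<V>. \<exists>U\<in>\<U>. V \<subseteq> U" using l(2) A(2) by (auto simp: \<V>_def)
    ultimately show "\<exists>\<V>. (\<forall>V\<in>\<V>. openin mtopology V) \<and> \<Union>\<V> = topspace mtopology \<and>
       (\<forall>V\<in>\<V>. \<exists>U\<in>\<U>. V \<subseteq> U) \<and>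
       (\<forall>x\<in>topspace mtopology. finite {V\<in>\<V>. x \<in> V} \<and> card {V\<in>\<V>. x \<in> V} \<le> N * 4 ^ N + 1)"
      by (intro exI[of _ \<V>]) (auto simp: \<V>_def)
  qed
  then show ?thesis unfolding finite_dimensional_def by blast
qed

section \<open>Sup distances of finitely many functions are doubling\<close>

text \<open>The pullback of the maximum norm distance along the map with coordinates
  \<open>F i\<close>. The inserted 0 gives a value for empty \<open>I\<close>.\<close>

definition sup_dist :: "'i set \<Rightarrow> ('i \<Rightarrow> 'a \<Rightarrow> real) \<Rightarrow> 'a \<Rightarrow> 'a \<Rightarrow> real" where
  "sup_dist I F x y = Max (insert 0 ((\<lambda>i. \<bar>F i x - F i y\<bar>) ` I))"

lemma sup_dist_le_iff:
  "finite I \<Longrightarrow> sup_dist I F x y \<le> c \<longleftrightarrow> 0 \<le> c \<and> (\<forall>i\<in>I. \<bar>F i x - F i y\<bar> \<le> c)"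
  by (auto simp: sup_dist_def)

lemma sup_dist_less_iff:
  "finite I \<Longrightarrow> sup_dist I F x y < c \<longleftrightarrow> 0 < c \<and> (\<forall>i\<in>I. \<bar>F i x - F i y\<bar> < c)"
  by (auto simp: sup_dist_def)

lemma sup_dist_upper: "\<lbrakk>finite I; i \<in> I\<rbrakk> \<Longrightarrow> \<bar>F i x - F i y\<bar> \<le> sup_dist I F x y"
  by (simp add: sup_dist_def)

lemma sup_dist_nonneg: "finite I \<Longrightarrow> 0 \<le> sup_dist I F x y"
  by (simp add: sup_dist_def)

lemma sup_dist_commute: "sup_dist I F x y = sup_dist I F y x"
  by (simp add: sup_dist_def abs_minus_commute)

lemma sup_dist_triangle:
  assumes "finite I"
  shows "sup_dist I F x z \<le> sup_dist I F x y + sup_dist I F y z"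
  unfolding sup_dist_le_iff[OF assms]
proof (intro conjI ballI)
  fix i assume "i \<in> I"
  then show "\<bar>F i x - F i z\<bar> \<le> sup_dist I F x y + sup_dist I F y z"
    using sup_dist_upper[OF assms, of i F x y] sup_dist_upper[OF assms, of i F y z] by linarith
qed (use sup_dist_nonneg[OF assms] in \<open>intro add_nonneg_nonneg\<close>)

lemma continuous_map_sup_dist:
  assumes "finite I" "\<And>i. i \<in> I \<Longrightarrow> continuous_map X euclideanreal (F i)"
  shows "continuous_map X euclideanreal (sup_dist I F x)"
  using assms
proof (induction I)
  case empty
  then show ?case by (simp add: sup_dist_def[abs_def])
next
  case (insert j I)
  have "sup_dist (insert j I) F x = (\<lambda>y. max \<bar>F j x - F j y\<bar> (sup_dist I F x y))"
    using insert(1) by (simp add: sup_dist_def fun_eq_iff insert_commute[of 0])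
  then show ?case using insert by (auto intro!: continuous_intros)
qed

text \<open>Round all coordinates to a grid whose mesh is the separation of \<open>A\<close>.
  Distinct points land in distinct cells, and the number of cells is controlled by a power of the
  ratio.\<close>

lemma doubling_sup_dist:
  fixes F :: "'i \<Rightarrow> 'a \<Rightarrow> real"
  assumes "finite I" and e: "Metric_space M e"
    and eq: "\<And>x y. \<lbrakk>x \<in> M; y \<in> M\<rbrakk> \<Longrightarrow> e x y = sup_dist I F x y"
  shows "doubling M e"
proof -
  interpret Metric_space M e by fact
  have "real (card A) \<le> 4 ^ card I * (diam_set e A / sep_set e A) powr (real (card I) + 1)"
    if A: "A \<subseteq> M" "finite A" "card A \<ge> 2" for A
  proof -
    define s where "s = sep_set e A"
    define D where "D = diam_set e A"
    have s: "s > 0" using sep_set_pos[OF A(2,1,3)] by (simp add: s_def)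
    have r: "1 \<le> D / s" using s sep_le_diam[OF A(2,3), of e] by (simp add: s_def D_def)
    obtain a where a: "a \<in> A" using A(3) by (metis card_ge_2_distinct)
    \<comment> \<open>All of \<open>A\<close> lies within \<open>D\<close> of the fixed point
      \<open>a\<close>, so these are the only possible cell indices in coordinate
      \<open>i\<close>.\<close>
    define B where "B i = {\<lfloor>F i a / s - D / s\<rfloor>..\<lfloor>F i a / s + D / s\<rfloor>}" for i
    define \<phi> where "\<phi> x = (\<lambda>i\<in>I. \<lfloor>F i x / s\<rfloor>)" for x
    have "\<phi> ` A \<subseteq> Pi\<^sub>E I B"
    proof
      fix v assume "v \<in> \<phi> ` A"
      then obtain x where x: "x \<in> A" "v = \<phi> x" by blast
      have "\<lfloor>F i x / s\<rfloor> \<in> B i" if i: "i \<in> I" for i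
      proof -
        have "\<bar>F i x - F i a\<bar> \<le> e x a" using x a A(1) eq sup_dist_upper[OF assms(1) i] by (metis subsetD)
        also have "\<dots> \<le> D" unfolding D_def using x a A by (intro diam_set_upper)
        finally have "F i a - D \<le> F i x" "F i x \<le> F i a + D" by linarith+
        then have "(F i a - D) / s \<le> F i x / s" "F i x / s \<le> (F i a + D) / s"
          using s by (simp_all add: divide_right_mono)
        then show ?thesis unfolding B_def by (auto intro!: floor_mono simp: diff_divide_distrib add_divide_distrib)
      qed
      then show "v \<in> Pi\<^sub>E I B" using x by (auto simp: \<phi>_def)
    qed
    \<comment> \<open>Points in one cell differ by less than \<open>s\<close> in every coordinate,
      whereas distinct points of \<open>A\<close> differ by at least \<open>s\<close> in some
      coordinate.\<close>
    moreover have "inj_on \<phi> A"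
    proof (rule inj_onI, rule ccontr)
      fix x y assume xy: "x \<in> A" "y \<in> A" "\<phi> x = \<phi> y" "x \<noteq> y"
      then have "s \<le> e x y" unfolding s_def using A by (intro sep_set_lower)
      then have "\<not> sup_dist I F x y < s" using eq xy A(1) by force
      then obtain i where i: "i \<in> I" "s \<le> \<bar>F i x - F i y\<bar>" using s by (auto simp: sup_dist_less_iff[OF assms(1)])
      then have "1 \<le> \<bar>F i x - F i y\<bar> / s" using s by simp
      then have "1 \<le> \<bar>F i x / s - F i y / s\<bar>" using s by (simp add: diff_divide_distrib[symmetric])
      moreover have "\<lfloor>F i x / s\<rfloor> = \<lfloor>F i y / s\<rfloor>" using xy(3) i(1) by (auto simp: \<phi>_def dest: fun_cong[of _ _ i])
      ultimately show False by linarith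
    qed
    moreover have fin: "finite (Pi\<^sub>E I B)" using assms(1) by (intro finite_PiE) (auto simp: B_def)
    ultimately have "card A \<le> card (Pi\<^sub>E I B)" by (metis card_inj_on_le)
    also have "\<dots> = (\<Prod>i\<in>I. card (B i))" using assms(1) by (rule card_PiE)
    finally have "real (card A) \<le> (\<Prod>i\<in>I. real (card (B i)))" by (metis of_nat_le_iff of_nat_prod)
    \<comment> \<open>An interval of this form has fewer than \<open>2 * (D / s) + 2\<close>
      integers, and \<open>D / s\<close> is at least 1.\<close>
    also have "\<dots> \<le> (\<Prod>i\<in>I. 4 * (D / s))"
    proof (intro prod_mono conjI)
      fix i
      have "\<lfloor>F i a / s - D / s\<rfloor> \<le> \<lfloor>F i a / s + D / s\<rfloor>" using r by (intro floor_mono) simp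
      then have "real (card (B i)) = real_of_int (\<lfloor>F i a / s + D / s\<rfloor> - \<lfloor>F i a / s - D / s\<rfloor> + 1)"
        by (simp add: B_def)
      then show "real (card (B i)) \<le> 4 * (D / s)" using r by linarith
    qed auto
    also have "\<dots> = 4 ^ card I * (D / s) ^ card I" by (simp add: power_mult_distrib[symmetric])
    \<comment> \<open>The exponent is raised by one because \<open>doubling\<close> asks for a
      positive one and \<open>I\<close> may be empty.\<close>
    also have "\<dots> \<le> 4 ^ card I * (D / s) ^ (card I + 1)"
      using r by (intro mult_left_mono power_increasing) auto
    also have "(D / s) ^ (card I + 1) = (D / s) powr (real (card I) + 1)"
      using r powr_realpow[of "D / s" "card I + 1"] by (simp add: add.commute)
    finally show ?thesis by (simp add: D_def s_def)
  qed
  then show ?thesis unfolding doubling_def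
    by (intro exI[of _ "real (card I) + 1"] exI[of _ "4 ^ card I"] conjI) auto
qed

text \<open>Continuity of the \<open>F i\<close> makes the metric topology coarser than
  \<open>X\<close>. The identity is then a continuous bijection from a compact space onto a
  Hausdorff one, hence a homeomorphism.\<close>

lemma sup_dist_doubling_metric:
  assumes "compact_space X" "finite I"
    and cont: "\<And>i. i \<in> I \<Longrightarrow> continuous_map X euclideanreal (F i)"
    and sep: "\<And>x y. \<lbrakk>x \<in> topspace X; y \<in> topspace X; x \<noteq> y\<rbrakk> \<Longrightarrow> \<exists>i\<in>I. F i x \<noteq> F i y"
  shows "(\<lambda>x y. if x \<in> topspace X \<and> y \<in> topspace X then sup_dist I F x y else 0) \<in> doubling_metrics X"
    (is "?e \<in> _")
proof -
  have e: "Metric_space (topspace X) ?e"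
  proof
    show "?e x y = 0 \<longleftrightarrow> x = y" if "x \<in> topspace X" "y \<in> topspace X" for x y
    proof
      assume "?e x y = 0"
      then have "sup_dist I F x y \<le> 0" using that by simp
      then show "x = y" using sep that by (force simp: sup_dist_le_iff[OF assms(2)])
    next
      assume "x = y"
      then have "sup_dist I F x y \<le> 0" by (simp add: sup_dist_le_iff[OF assms(2)])
      then show "?e x y = 0" using sup_dist_nonneg[OF assms(2), of F x y] by simp
    qed
  qed (auto simp: sup_dist_nonneg[OF assms(2)] sup_dist_commute sup_dist_triangle[OF assms(2)])
  interpret Metric_space "topspace X" ?e by fact
  have cont_e: "continuous_map X euclideanreal (?e x)" if "x \<in> topspace X" for x
    using continuous_map_sup_dist[of I X F x, OF assms(2) cont] that by (auto elim!: continuous_map_eq)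
  have "continuous_map X mtopology id"
    using openin_of_continuous_metric[OF e cont_e] openin_subset[of mtopology]
    by (auto simp: continuous_map_def Collect_conj_eq Int_absorb1)
  then have "homeomorphic_map X mtopology id"
    using assms(1) Hausdorff_space_mtopology by (intro continuous_imp_homeomorphic_map) auto
  then have "mtopology = X" by simp
  moreover have "doubling (topspace X) ?e"
    using assms(2) e by (rule doubling_sup_dist) auto
  ultimately show ?thesis using e by (auto simp: doubling_metrics_def met_space_def)
qed

section \<open>Separating points by finitely many functions in finite dimension\<close>

text \<open>Each new value comes from an open interval, which is infinite, so it can avoid the
  finitely many values already used.\<close>

lemma finite_inj_approx:
  fixes f :: "'b \<Rightarrow> real"
  assumes "finite A" "\<eta> > 0"
  shows "\<exists>c. inj_on c A \<and> (\<forall>a\<in>A. \<bar>c a - f a\<bar> < \<eta>)"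
  using assms(1)
proof induction
  case (insert a A)
  then obtain c where c: "inj_on c A" "\<forall>a\<in>A. \<bar>c a - f a\<bar> < \<eta>" by blast
  have "infinite ({f a - \<eta><..<f a + \<eta>} - c ` A)"
    using assms(2) insert(1) by (simp add: infinite_Ioo)
  then obtain v where v: "v \<in> {f a - \<eta><..<f a + \<eta>} - c ` A" by (meson finite.emptyI finite_subset subsetI)
  have "inj_on (c(a := v)) (insert a A)"
    using c(1) v insert(2) by (auto simp: inj_on_def)
  moreover have "\<forall>b\<in>insert a A. \<bar>(c(a := v)) b - f b\<bar> < \<eta>" using c(2) v by auto
  ultimately show ?case by blast
qed auto

lemma finite_real_gap:
  fixes A :: "real set"
  assumes "finite A"
  shows "\<exists>\<delta>>0. \<forall>a\<in>A. \<forall>b\<in>A. a \<noteq> b \<longrightarrow> \<delta> < \<bar>a - b\<bar>"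
proof -
  \<comment> \<open>The extra 1 keeps the minimum defined when \<open>A\<close> has fewer than two
    elements. Halving the minimum makes the gap strict.\<close>
  let ?S = "insert 1 {\<bar>a - b\<bar> | a b. a \<in> A \<and> b \<in> A \<and> a \<noteq> b}"
  have fin: "finite ?S" using finite_dist_values[OF assms, of "\<lambda>a b. \<bar>a - b\<bar>" "(\<noteq>)"] by simp
  have "Min ?S > 0" using fin by (subst Min_gr_iff) auto
  moreover have "Min ?S \<le> \<bar>a - b\<bar>" if "a \<in> A" "b \<in> A" "a \<noteq> b" for a b
    using fin that by (intro Min_le) auto
  ultimately show ?thesis by (intro exI[of _ "Min ?S / 2"]) fastforce
qed

text \<open>The cells of colour \<open>i\<close> record which of the functions \<open>\<phi> W\<close> lie above the \<open>i\<close>-th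
  threshold, leaving out the points where one of them is close to that threshold. At most
  \<open>n + 1\<close> of the \<open>\<phi> W\<close> are nonzero at a point and each is close to at most one threshold, so every
  point is left out by at most \<open>n + 1\<close> of the \<open>2 n + 3\<close> colours.\<close>

lemma (in Metric_space) colour_families:
  assumes comp: "compact_space mtopology" and dim: "covering_dim_le mtopology n"
    and U: "finite \<U>" "\<And>U. U \<in> \<U> \<Longrightarrow> openin mtopology U" "\<Union>\<U> = M"
  obtains \<G> :: "nat \<Rightarrow> 'a set set" where
    "\<And>i. finite (\<G> i)" "\<And>i G. G \<in> \<G> i \<Longrightarrow> closedin mtopology G"
    "\<And>i G H x. \<lbrakk>G \<in> \<G> i; H \<in> \<G> i; x \<in> G; x \<in> H\<rbrakk> \<Longrightarrow> G = H"
    "\<And>i G. G \<in> \<G> i \<Longrightarrow> \<exists>U\<in>\<U>. G \<subseteq> U"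
    "\<And>x y. \<lbrakk>x \<in> M; y \<in> M\<rbrakk> \<Longrightarrow> \<exists>i<2*n+3. x \<in> \<Union>(\<G> i) \<and> y \<in> \<Union>(\<G> i)"
proof -
  obtain \<V> where V: "\<And>V. V \<in> \<V> \<Longrightarrow> openin mtopology V" "\<Union>\<V> = M" "\<And>V. V \<in> \<V> \<Longrightarrow> \<exists>U\<in>\<U>. V \<subseteq> U"
    "\<And>x. x \<in> M \<Longrightarrow> finite {V\<in>\<V>. x \<in> V} \<and> card {V\<in>\<V>. x \<in> V} \<le> n + 1"
  proof -
    have "\<exists>\<V>. (\<forall>V\<in>\<V>. openin mtopology V) \<and> \<Union>\<V> = M \<and> (\<forall>V\<in>\<V>. \<exists>U\<in>\<U>. V \<subseteq> U) \<and>
        (\<forall>x\<in>M. finite {V\<in>\<V>. x \<in> V} \<and> card {V\<in>\<V>. x \<in> V} \<le> n + 1)"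
      using dim[unfolded covering_dim_le_def, rule_format, of \<U>] U by simp
    then obtain \<V> where "\<forall>V\<in>\<V>. openin mtopology V" "\<Union>\<V> = M" "\<forall>V\<in>\<V>. \<exists>U\<in>\<U>. V \<subseteq> U"
        "\<forall>x\<in>M. finite {V\<in>\<V>. x \<in> V} \<and> card {V\<in>\<V>. x \<in> V} \<le> n + 1" by (elim exE conjE)
    then show thesis by (intro that[of \<V>]) simp_all
  qed
  obtain \<W> where W: "finite \<W>" "\<W> \<subseteq> \<V>" "\<Union>\<W> = M"
    using comp[unfolded compact_space, rule_format, of \<V>] V(1,2) by auto
  have mult: "card {W\<in>\<W>. x \<in> W} \<le> n + 1" if "x \<in> M" for x
  proof -
    have "card {W\<in>\<W>. x \<in> W} \<le> card {V\<in>\<V>. x \<in> V}"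
      using V(4)[OF that] W(2) by (intro card_mono) auto
    then show ?thesis using V(4)[OF that] by linarith
  qed
  obtain b where b: "b > 0" "\<And>x. x \<in> M \<Longrightarrow> \<exists>W\<in>\<W>. mball x b \<subseteq> W"
  proof -
    have "compactin mtopology M" using comp by (simp add: compact_space_def)
    moreover have "M \<subseteq> \<Union>\<W>" "\<And>W. W \<in> \<W> \<Longrightarrow> openin mtopology W" using V(1) W by auto
    ultimately show thesis using lebesgue_number[of M \<W>] that by blast
  qed
  \<comment> \<open>The distance from \<open>x\<close> to the complement of \<open>W\<close>, capped
    at the Lebesgue number \<open>b\<close>. Inserting \<open>b\<close> also gives a value when
    \<open>W\<close> is all of \<open>M\<close>.\<close>
  define \<phi> where "\<phi> W x = Inf (insert b (d x ` (M - W)))" for W x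
  have bdd: "bdd_below (insert b (d x ` (M - W)))" for x W
    by (rule bdd_belowI[of _ 0]) (use b in auto)
  have phi_dist: "\<phi> W x \<le> d x y" if "y \<in> M - W" for W x y
    unfolding \<phi>_def using that by (intro cInf_lower bdd) auto
  have phi_b: "\<phi> W x \<le> b" for W x
    unfolding \<phi>_def by (intro cInf_lower bdd) auto
  have phi_ge: "c \<le> \<phi> W x" if "c \<le> b" "\<And>y. y \<in> M - W \<Longrightarrow> c \<le> d x y" for c W x
    unfolding \<phi>_def using that by (intro cInf_greatest) auto
  have phi_in: "x \<in> W" if "x \<in> M" "0 < \<phi> W x" for x W
    using phi_dist[of x W x] that by force
  have phi_lip: "\<phi> W x - d x y \<le> \<phi> W y" if "x \<in> M" "y \<in> M" for W x y
  proof (rule phi_ge)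
    show "\<phi> W x - d x y \<le> b" using phi_b[of W x] nonneg[of x y] by linarith
    show "\<phi> W x - d x y \<le> d y z" if z: "z \<in> M - W" for z
      using phi_dist[OF z, of x] triangle[of x y z] z \<open>x \<in> M\<close> \<open>y \<in> M\<close> by auto
  qed
  \<comment> \<open>Some \<open>W\<close> contains the whole ball of radius \<open>b\<close> around
    \<open>x\<close>, so its function reaches the cap there.\<close>
  have phi_top: "\<exists>W\<in>\<W>. b \<le> \<phi> W x" if x: "x \<in> M" for x
  proof -
    obtain W where "W \<in> \<W>" "mball x b \<subseteq> W" using b(2)[OF x] by blast
    moreover have "b \<le> \<phi> W x"
    proof (rule phi_ge)
      show "b \<le> d x y" if "y \<in> M - W" for y
        using that \<open>x \<in> M\<close> \<open>mball x b \<subseteq> W\<close> by (meson DiffE in_mball not_less subsetD)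
    qed simp
    ultimately show ?thesis by blast
  qed
  have phi_cont: "continuous_map mtopology euclideanreal (\<phi> W)" for W
    unfolding continuous_map_from_metric
  proof (intro conjI ballI allI impI)
    fix x T assume x: "x \<in> M" and T: "openin euclideanreal T \<and> \<phi> W x \<in> T"
    then obtain r where r: "r > 0" "ball (\<phi> W x) r \<subseteq> T" by (meson open_contains_ball open_openin)
    have "\<phi> W y \<in> T" if "y \<in> M" "d x y < r" for y
    proof -
      have "\<bar>\<phi> W x - \<phi> W y\<bar> < r"
        using phi_lip[OF x that(1), of W] phi_lip[OF that(1) x, of W] that(2) by (simp add: commute)
      then show ?thesis using r(2) by (auto simp: dist_real_def)
    qed
    then show "\<exists>r>0. \<forall>y. y \<in> M \<and> d x y < r \<longrightarrow> \<phi> W y \<in> T" using r(1) by blast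
  qed auto
  \<comment> \<open>The open bands from \<open>(2 * i + 1) * c\<close> to
    \<open>(2 * i + 3) * c\<close> are disjoint. The highest one, for \<open>i = 2 * n + 2\<close>,
    ends at \<open>(4 * n + 7) * c\<close>, which is below \<open>b\<close>.\<close>
  define c where "c = b / (4 * real n + 8)"
  have c: "c > 0" using b(1) by (simp add: c_def)
  have top: "(2 * real i + 3) * c \<le> b" if "i < 2*n+3" for i
  proof -
    have "(2 * real i + 3) * c \<le> (4 * real n + 8) * c" using c that by (intro mult_right_mono) linarith+
    then show ?thesis by (simp add: c_def)
  qed
  define G where "G i S = {x\<in>M. (\<forall>W\<in>S. (2 * real i + 3) * c \<le> \<phi> W x) \<and>
                                (\<forall>W\<in>\<W>-S. \<phi> W x \<le> (2 * real i + 1) * c)}" for i S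
  \<comment> \<open>Excluding the empty \<open>S\<close> puts every cell inside some
    \<open>W\<close>, hence inside a member of \<open>\<U>\<close>.\<close>
  define \<G> where "\<G> i = G i ` (Pow \<W> - {{}})" for i
  define bad where "bad x = {i. i < 2*n+3 \<and> (\<exists>W\<in>\<W>. (2 * real i + 1) * c < \<phi> W x \<and> \<phi> W x < (2 * real i + 3) * c)}" for x
  have bad_card: "card (bad x) \<le> n + 1" if x: "x \<in> M" for x
  proof -
    \<comment> \<open>The value \<open>\<phi> W x\<close> determines the band containing it, so each
      \<open>W\<close> accounts for at most one bad colour. Such a \<open>W\<close> contains
      \<open>x\<close>, because the bands lie above 0.\<close>
    have "bad x \<subseteq> (\<lambda>W. nat \<lfloor>(\<phi> W x / c - 1) / 2\<rfloor>) ` {W\<in>\<W>. x \<in> W}"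
    proof
      fix i assume "i \<in> bad x"
      then obtain W where W': "W \<in> \<W>" "(2 * real i + 1) * c < \<phi> W x" "\<phi> W x < (2 * real i + 3) * c"
        by (auto simp: bad_def)
      then have "2 * real i + 1 < \<phi> W x / c" "\<phi> W x / c < 2 * real i + 3"
        using c by (simp_all add: field_simps)
      then have "\<lfloor>(\<phi> W x / c - 1) / 2\<rfloor> = int i" by (intro floor_unique) auto
      moreover have "0 < (2 * real i + 1) * c" using c by simp
      then have "x \<in> W" using W'(2) by (intro phi_in[OF x]) linarith
      ultimately show "i \<in> (\<lambda>W. nat \<lfloor>(\<phi> W x / c - 1) / 2\<rfloor>) ` {W\<in>\<W>. x \<in> W}"
        using W'(1) by (intro image_eqI[of _ _ W]) auto
    qed
    then have "card (bad x) \<le> card {W\<in>\<W>. x \<in> W}" using W(1) by (intro surj_card_le) auto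
    then show ?thesis using mult[OF x] by linarith
  qed
  have good: "x \<in> \<Union>(\<G> i)" if x: "x \<in> M" and i: "i < 2*n+3" "i \<notin> bad x" for x i
  proof -
    define S where "S = {W\<in>\<W>. (2 * real i + 3) * c \<le> \<phi> W x}"
    have "S \<noteq> {}" using phi_top[OF x] top[OF i(1)] by (force simp: S_def)
    moreover have "x \<in> G i S" using x i by (auto simp: G_def S_def bad_def not_le not_less) 
    ultimately show ?thesis by (auto simp: \<G>_def S_def)
  qed
  show thesis
  proof
    show "finite (\<G> i)" for i using W(1) by (simp add: \<G>_def)
    show "closedin mtopology C" if C: "C \<in> \<G> i" for i C
    proof -
      obtain S where S: "S \<subseteq> \<W>" "C = G i S" using C by (auto simp: \<G>_def)
      have "C = M \<inter> (\<Inter>W\<in>S. {x\<in>topspace mtopology. \<phi> W x \<in> {(2 * real i + 3) * c..}})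
              \<inter> (\<Inter>W\<in>\<W>-S. {x\<in>topspace mtopology. \<phi> W x \<in> {..(2 * real i + 1) * c}})"
        unfolding S(2) G_def by auto
      also have "closedin mtopology \<dots>"
      proof -
        have *: "closedin mtopology {x\<in>topspace mtopology. \<phi> W x \<in> K}" if "closed K" for W K
          using phi_cont that by (intro closedin_continuous_map_preimage) auto
        \<comment> \<open>The factor \<open>M\<close> takes care of empty \<open>T\<close>, where
          the bare intersection would be the whole type.\<close>
        have **: "closedin mtopology (M \<inter> (\<Inter>W\<in>T. {x\<in>topspace mtopology. \<phi> W x \<in> K}))" if "closed K" for T K
          using *[OF that] closedin_Inter[of "insert M ((\<lambda>W. {x\<in>topspace mtopology. \<phi> W x \<in> K}) ` T)" mtopology]
          by auto
        have "closedin mtopology ((M \<inter> (\<Inter>W\<in>S. {x\<in>topspace mtopology. \<phi> W x \<in> {(2 * real i + 3) * c..}}))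
              \<inter> (M \<inter> (\<Inter>W\<in>\<W>-S. {x\<in>topspace mtopology. \<phi> W x \<in> {..(2 * real i + 1) * c}})))"
          by (intro closedin_Int **) auto
        then show ?thesis by (rule back_subst) auto
      qed
      finally show ?thesis .
    qed
    show "C = E" if CE: "C \<in> \<G> i" "E \<in> \<G> i" "x \<in> C" "x \<in> E" for i C E x
    proof -
      obtain S T where S: "S \<subseteq> \<W>" "C = G i S" and T: "T \<subseteq> \<W>" "E = G i T" using CE by (auto simp: \<G>_def)
      have lt: "(2 * real i + 1) * c < (2 * real i + 3) * c" using c by simp
      \<comment> \<open>Membership of \<open>W\<close> is read off from the side of the band on
        which \<open>\<phi> W x\<close> lies, and the band has positive width.\<close>
      have "W \<in> S \<longleftrightarrow> W \<in> T" if "W \<in> \<W>" for W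
      proof -
        have "x \<in> G i S" "x \<in> G i T" using CE S T by auto
        then show ?thesis using lt that by (cases "W \<in> S"; cases "W \<in> T") (force simp: G_def)+
      qed
      then have "S = T" using S T by blast
      then show ?thesis using S T by simp
    qed
    show "\<exists>U\<in>\<U>. C \<subseteq> U" if C: "C \<in> \<G> i" for i C
    proof -
      obtain S W where S: "S \<subseteq> \<W>" "C = G i S" "W \<in> S" using C by (auto simp: \<G>_def)
      have "0 < (2 * real i + 3) * c" using c by simp
      then have "C \<subseteq> W" using S phi_in[of _ W] by (force simp: G_def)
      then show ?thesis using V(3)[of W] S W(2) by blast
    qed
    show "\<exists>i<2*n+3. x \<in> \<Union>(\<G> i) \<and> y \<in> \<Union>(\<G> i)" if xy: "x \<in> M" "y \<in> M" for x y
    proof -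
      \<comment> \<open>Two points together rule out at most \<open>2 * n + 2\<close> of the
        \<open>2 * n + 3\<close> colours.\<close>
      have "card (bad x \<union> bad y) < card {..<2*n+3}"
        using card_Un_le[of "bad x" "bad y"] bad_card[OF xy(1)] bad_card[OF xy(2)] by simp
      moreover have "bad x \<union> bad y \<subseteq> {..<2*n+3}" by (auto simp: bad_def)
      ultimately obtain i where "i < 2*n+3" "i \<notin> bad x" "i \<notin> bad y"
        by (metis Un_iff lessThan_iff nless_le subsetI subset_antisym)
      then show ?thesis using good xy by blast
    qed
  qed
qed

text \<open>Take the colour families of a cover fine in \<open>d\<close> and in the oscillation of
  every \<open>g i\<close>. Making \<open>g' i\<close> constant on each cell, with distinct
  constants, is a small change, and two points at distance at least \<open>\<epsilon>\<close> never
  share a cell.\<close>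

lemma (in Metric_space) perturb_to_separate:
  fixes g :: "nat \<Rightarrow> 'a \<Rightarrow> real"
  assumes comp: "compact_space mtopology" and dim: "covering_dim_le mtopology n"
    and cont: "\<And>i. i < 2*n+3 \<Longrightarrow> continuous_map mtopology euclideanreal (g i)"
    and "\<eta> > 0" "\<epsilon> > 0"
  obtains g' :: "nat \<Rightarrow> 'a \<Rightarrow> real" and \<delta> where
    "\<And>i. i < 2*n+3 \<Longrightarrow> continuous_map mtopology euclideanreal (g' i)"
    "\<And>i x. \<lbrakk>i < 2*n+3; x \<in> M\<rbrakk> \<Longrightarrow> \<bar>g' i x - g i x\<bar> \<le> \<eta>"
    "\<delta> > 0" "\<And>x y. \<lbrakk>x \<in> M; y \<in> M; \<epsilon> \<le> d x y\<rbrakk> \<Longrightarrow> \<exists>i<2*n+3. \<delta> < \<bar>g' i x - g' i y\<bar>"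
proof -
  \<comment> \<open>With these radii, two points of \<open>N x\<close> are closer than
    \<open>\<epsilon>\<close> and their values under each \<open>g i\<close> differ by less than
    \<open>\<eta>/2\<close>.\<close>
  define N where "N x = mball x (\<epsilon>/2) \<inter> (\<Inter>i\<in>{..<2*n+3}. {y\<in>topspace mtopology. g i y \<in> ball (g i x) (\<eta>/4)})" for x
  have N_open: "openin mtopology (N x)" for x
    unfolding N_def
    using cont by (intro openin_Int openin_mball openin_INT2 openin_continuous_map_preimage)
      (auto simp: lessThan_empty_iff)
  have N_in: "x \<in> N x" if "x \<in> M" for x using that assms by (simp add: N_def)
  have N_M: "N x \<subseteq> M" for x by (auto simp: N_def)
  have "\<exists>\<F>. finite \<F> \<and> \<F> \<subseteq> N ` M \<and> \<Union>\<F> = M"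
    using comp[unfolded compact_space, rule_format, of "N ` M"] N_open N_in N_M by fastforce
  then obtain \<U> where U: "finite \<U>" "\<U> \<subseteq> N ` M" "\<Union>\<U> = M" by blast
  have U_open: "openin mtopology U" if "U \<in> \<U>" for U using that U(2) N_open by blast
  have U_small: "d y z < \<epsilon> \<and> (\<forall>i<2*n+3. \<bar>g i y - g i z\<bar> < \<eta>/2)" if yz: "U \<in> \<U>" "y \<in> U" "z \<in> U" for U y z
  proof -
    obtain x where x: "x \<in> M" "U = N x" using U(2) yz(1) by blast
    have "d x y < \<epsilon>/2" "d x z < \<epsilon>/2" "y \<in> M" "z \<in> M" using yz x by (auto simp: N_def)
    then have "d y z < \<epsilon>" using triangle''[of y x z] x(1) by linarith
    moreover have "\<bar>g i y - g i z\<bar> < \<eta>/2" if "i < 2*n+3" for i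
    proof -
      have "\<bar>g i x - g i y\<bar> < \<eta>/4" "\<bar>g i x - g i z\<bar> < \<eta>/4" using yz x that by (auto simp: N_def dist_real_def)
      then show ?thesis by linarith
    qed
    ultimately show ?thesis by blast
  qed
  obtain \<G> :: "nat \<Rightarrow> 'a set set" where G:
    "\<And>i. finite (\<G> i)" "\<And>i G. G \<in> \<G> i \<Longrightarrow> closedin mtopology G"
    "\<And>i G H x. \<lbrakk>G \<in> \<G> i; H \<in> \<G> i; x \<in> G; x \<in> H\<rbrakk> \<Longrightarrow> G = H"
    "\<And>i G. G \<in> \<G> i \<Longrightarrow> \<exists>U\<in>\<U>. G \<subseteq> U"
    "\<And>x y. \<lbrakk>x \<in> M; y \<in> M\<rbrakk> \<Longrightarrow> \<exists>i<2*n+3. x \<in> \<Union>(\<G> i) \<and> y \<in> \<Union>(\<G> i)"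
  proof (rule colour_families[OF comp dim U(1) _ U(3)], goal_cases)
    case (1 U)
    then show ?case using U_open by blast
  next
    case prems: (2 \<G>)
    show ?case by (rule prems(1)[OF prems(2-6)])
  qed
  \<comment> \<open>The constant is within \<open>\<eta>/2\<close> of \<open>g i\<close> at one
    point of the cell; oscillation costs at most another \<open>\<eta>/2\<close>.\<close>
  have "\<exists>c. inj_on c (\<G> i) \<and> (\<forall>G\<in>\<G> i. \<bar>c G - g i (SOME p. p \<in> G)\<bar> < \<eta>/2)" for i
    using finite_inj_approx[OF G(1), of "\<eta>/2" i] \<open>\<eta> > 0\<close> by simp
  then obtain c where c: "\<And>i. inj_on (c i) (\<G> i)" "\<And>i G. G \<in> \<G> i \<Longrightarrow> \<bar>c i G - g i (SOME p. p \<in> G)\<bar> < \<eta>/2"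
    by metis
  have "\<exists>h. continuous_map mtopology euclideanreal h \<and> (\<forall>x\<in>M. \<bar>h x - g i x\<bar> \<le> \<eta>) \<and>
            (\<forall>G\<in>\<G> i. \<forall>x\<in>G. h x = c i G)" if i: "i < 2*n+3" for i
  proof -
    \<comment> \<open>Tietze extension is applied to the correction \<open>k\<close> rather than to
      the constants themselves: \<open>k\<close> takes values in \<open>{-\<eta>..\<eta>}\<close>,
      and so does its extension. Disjointness of the cells makes \<open>k\<close> well
      defined.\<close>
    define k where "k x = c i (THE G. G \<in> \<G> i \<and> x \<in> G) - g i x" for x
    have k: "k x = c i G - g i x" if "G \<in> \<G> i" "x \<in> G" for G x
    proof -
      have "(THE G. G \<in> \<G> i \<and> x \<in> G) = G" using that G(3) by (intro the_equality) blast+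
      then show ?thesis by (simp add: k_def)
    qed
    have clo: "closedin mtopology (\<Union>(\<G> i))" using G(1,2) by (intro closedin_Union) auto
    have k_cont: "continuous_map (subtopology mtopology (\<Union>(\<G> i))) euclideanreal k"
    proof (rule pasting_lemma_closed[of "\<G> i" _ "\<lambda>G. G" _ "\<lambda>G x. c i G - g i x"])
      show "finite (\<G> i)" by (rule G(1))
      show "closedin (subtopology mtopology (\<Union> (\<G> i))) G" if "G \<in> \<G> i" for G
        using that G(2) by (intro closedin_subset_topspace) auto
      show "continuous_map (subtopology (subtopology mtopology (\<Union> (\<G> i))) G) euclideanreal (\<lambda>x. c i G - g i x)" for G
        by (intro continuous_map_diff continuous_map_from_subtopology cont i) auto
    qed (use G(3) k in auto)
    have k_bound: "k ` \<Union>(\<G> i) \<subseteq> {-\<eta>..\<eta>}"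
    proof (clarify)
      fix x C assume x: "x \<in> C" "C \<in> \<G> i"
      then have p: "(SOME p. p \<in> C) \<in> C" by (metis someI)
      obtain U where "U \<in> \<U>" "C \<subseteq> U" using G(4)[OF x(2)] by blast
      then have "\<bar>g i (SOME p. p \<in> C) - g i x\<bar> < \<eta>/2" using U_small[of U "SOME p. p \<in> C" x] p x i by blast
      then have "\<bar>k x\<bar> \<le> \<eta>" using c(2)[OF x(2)] k[OF x(2,1)] by linarith
      then show "k x \<in> {-\<eta>..\<eta>}" by auto
    qed
    have normal: "normal_space mtopology" by (simp add: metrizable_imp_normal_space metrizable_space_mtopology)
    have "-\<eta> \<le> \<eta>" using \<open>\<eta> > 0\<close> by simp
    then obtain u where u: "continuous_map mtopology euclideanreal u" "\<And>x. x \<in> \<Union>(\<G> i) \<Longrightarrow> u x = k x"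
      "u ` topspace mtopology \<subseteq> {-\<eta>..\<eta>}"
      using Tietze_extension_closed_real_interval[OF normal clo k_cont k_bound] by blast
    show ?thesis
    proof (intro exI[of _ "\<lambda>x. g i x + u x"] conjI ballI)
      show "continuous_map mtopology euclideanreal (\<lambda>x. g i x + u x)"
        using cont[OF i] u(1) by (intro continuous_intros)
      show "\<bar>g i x + u x - g i x\<bar> \<le> \<eta>" if "x \<in> M" for x using u(3) that by (auto simp: image_subset_iff abs_le_iff)
      show "g i x + u x = c i G" if "G \<in> \<G> i" "x \<in> G" for G x using u(2)[OF UnionI[OF that]] k[OF that] by simp
    qed
  qed
  then obtain g' where g': "\<And>i. i < 2*n+3 \<Longrightarrow> continuous_map mtopology euclideanreal (g' i) \<and>
      (\<forall>x\<in>M. \<bar>g' i x - g i x\<bar> \<le> \<eta>) \<and> (\<forall>G\<in>\<G> i. \<forall>x\<in>G. g' i x = c i G)" by metis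
  \<comment> \<open>Only finitely many constants occur over all colours, so one gap
    \<open>\<delta>\<close> serves for every pair of points.\<close>
  define C where "C = (\<Union>i<2*n+3. c i ` \<G> i)"
  have "finite C" using G(1) by (simp add: C_def)
  then obtain \<delta> where \<delta>: "\<delta> > 0" "\<forall>a\<in>C. \<forall>b\<in>C. a \<noteq> b \<longrightarrow> \<delta> < \<bar>a - b\<bar>"
    using finite_real_gap by blast
  show thesis
  proof
    show "\<exists>i<2*n+3. \<delta> < \<bar>g' i x - g' i y\<bar>" if xy: "x \<in> M" "y \<in> M" "\<epsilon> \<le> d x y" for x y
    proof -
      obtain i A B where i: "i < 2*n+3" and A: "A \<in> \<G> i" "x \<in> A" and B: "B \<in> \<G> i" "y \<in> B"
        using G(5)[OF xy(1,2)] by blast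
      have "A \<noteq> B" using G(4)[OF A(1)] U_small A(2) B(2) xy(3) by (metis linorder_not_le subsetD)
      then have "c i A \<noteq> c i B" using c(1) A B by (meson inj_onD)
      then have "\<delta> < \<bar>c i A - c i B\<bar>" using \<delta>(2) A B i by (auto simp: C_def)
      then show ?thesis using g'[OF i] A B i by auto
    qed
  qed (use g' \<delta> in auto)
qed

text \<open>Stage \<open>k\<close> separates points at distance at least \<open>1 / (k + 1)\<close>
  by a gap. All later perturbations together are too small to close that gap, so the uniform limit
  still separates.\<close>

lemma (in Metric_space) finite_dimensional_separating_functions:
  assumes comp: "compact_space mtopology" and dim: "covering_dim_le mtopology n"
  obtains f :: "nat \<Rightarrow> 'a \<Rightarrow> real" where
    "\<And>i. i < 2*n+3 \<Longrightarrow> continuous_map mtopology euclideanreal (f i)"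
    "\<And>x y. \<lbrakk>x \<in> M; y \<in> M; x \<noteq> y\<rbrakk> \<Longrightarrow> \<exists>i<2*n+3. f i x \<noteq> f i y"
proof -
  \<comment> \<open>\<open>P\<close> records the functions and gap of stage \<open>k\<close>;
    \<open>Q\<close> limits both the next change and the next gap to a quarter of the current
    gap.\<close>
  define P where "P k p \<longleftrightarrow> (case p of (g, \<delta>) \<Rightarrow>
      (\<forall>i<2*n+3. continuous_map mtopology euclideanreal (g i)) \<and> 0 < \<delta> \<and> \<delta> \<le> (1/4)^k \<and>
      (\<forall>x\<in>M. \<forall>y\<in>M. 1 / real (Suc k) \<le> d x y \<longrightarrow> (\<exists>i<2*n+3. \<delta> < \<bar>g i x - g i y\<bar>)))"
    for k :: nat and p :: "(nat \<Rightarrow> 'a \<Rightarrow> real) \<times> real"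
  define Q where "Q p q \<longleftrightarrow> (\<forall>i<2*n+3. \<forall>x\<in>M. \<bar>fst q i x - fst p i x\<bar> \<le> snd p / 4) \<and> snd q \<le> snd p / 4"
    for p q :: "(nat \<Rightarrow> 'a \<Rightarrow> real) \<times> real"
  have step: "\<exists>q. P k q \<and> (\<forall>i<2*n+3. \<forall>x\<in>M. \<bar>fst q i x - g i x\<bar> \<le> \<eta>) \<and> snd q \<le> \<eta>"
    if g: "\<And>i. i < 2*n+3 \<Longrightarrow> continuous_map mtopology euclideanreal (g i)" and "\<eta> > 0" for g k \<eta>
  proof -
    obtain g' \<delta> where g': "\<And>i. i < 2*n+3 \<Longrightarrow> continuous_map mtopology euclideanreal (g' i)"
      "\<And>i x. \<lbrakk>i < 2*n+3; x \<in> M\<rbrakk> \<Longrightarrow> \<bar>g' i x - g i x\<bar> \<le> \<eta>"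
      "\<delta> > 0" "\<And>x y. \<lbrakk>x \<in> M; y \<in> M; 1 / real (Suc k) \<le> d x y\<rbrakk> \<Longrightarrow> \<exists>i<2*n+3. \<delta> < \<bar>g' i x - g' i y\<bar>"
      using perturb_to_separate[where g = g and \<epsilon> = "1 / real (Suc k)", OF comp dim g \<open>\<eta> > 0\<close>]
      by (auto simp del: of_nat_Suc)
    \<comment> \<open>Shrinking the gap preserves separation, so it can also meet the bounds
      required by \<open>Q\<close> and by convergence.\<close>
    have "P k (g', min \<delta> (min \<eta> ((1/4)^k)))"
      unfolding P_def prod.case
    proof (intro conjI ballI impI)
      show "\<exists>i<2*n+3. min \<delta> (min \<eta> ((1/4)^k)) < \<bar>g' i x - g' i y\<bar>"
        if "x \<in> M" "y \<in> M" "1 / real (Suc k) \<le> d x y" for x y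
        using g'(4)[OF that] by (meson min.strict_coboundedI1)
    qed (use g' \<open>\<eta> > 0\<close> in auto)
    then show ?thesis using g'(2) by (intro exI[of _ "(g', min \<delta> (min \<eta> ((1/4)^k)))"]) auto
  qed
  obtain p where p: "\<And>k. P k (p k)" "\<And>k. Q (p k) (p (Suc k))"
  proof -
    have "\<exists>p. \<forall>k. P k (p k) \<and> Q (p k) (p (Suc k))"
    proof (rule dependent_nat_choice)
      show "\<exists>q. P 0 q" using step[of "\<lambda>_ _. 0" 1 0] by auto
      show "\<exists>q. P (Suc k) q \<and> Q r q" if "P k r" for r k
        using step[of "fst r" "snd r / 4" "Suc k"] that unfolding P_def Q_def by (cases r) auto
    qed
    then show thesis using that by blast
  qed
  define g where "g k = fst (p k)" for k
  define \<delta> where "\<delta> k = snd (p k)" for k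
  have cont: "\<And>k i. i < 2*n+3 \<Longrightarrow> continuous_map mtopology euclideanreal (g k i)"
    and \<delta>: "\<And>k. 0 < \<delta> k" "\<And>k. \<delta> k \<le> (1/4)^k"
    and sep: "\<And>k x y. \<lbrakk>x \<in> M; y \<in> M; 1 / real (Suc k) \<le> d x y\<rbrakk> \<Longrightarrow> \<exists>i<2*n+3. \<delta> k < \<bar>g k i x - g k i y\<bar>"
    using p(1) by (auto simp: P_def g_def \<delta>_def case_prod_beta)
  have close: "\<bar>g (Suc k) i x - g k i x\<bar> \<le> \<delta> k / 4" and \<delta>_Suc: "\<delta> (Suc k) \<le> \<delta> k / 4"
    if "i < 2*n+3" "x \<in> M" for k i x
    using p(2)[of k] that by (auto simp: Q_def g_def \<delta>_def)
  \<comment> \<open>The constant 3/8 closes the induction, as \<open>1/4 + (3/8)/4\<close> is below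
    it, and twice 3/8 is still less than 1.\<close>
  have drift: "\<bar>g (k + j) i x - g k i x\<bar> \<le> 3/8 * \<delta> k" if "i < 2*n+3" "x \<in> M" for k j i x
  proof (induction j arbitrary: k)
    case 0
    then show ?case using \<delta>(1)[of k] by simp
  next
    case (Suc j)
    show ?case using Suc[of "Suc k"] close[OF that, of k] \<delta>_Suc[OF that, of k] \<delta>(1)[of k]
      unfolding add_Suc_right add_Suc by linarith
  qed
  define f where "f i x = lim (\<lambda>k. g k i x)" for i x
  have lim: "(\<lambda>k. g k i x) \<longlonglongrightarrow> f i x" if ix: "i < 2*n+3" "x \<in> M" for i x
  proof -
    have "Cauchy (\<lambda>k. g k i x)"
    proof (rule metric_CauchyI)
      fix \<epsilon> :: real assume "\<epsilon> > 0"
      obtain k where k: "(1/4::real)^k < \<epsilon>" using real_arch_pow_inv[OF \<open>\<epsilon> > 0\<close>, of "1/4"] by auto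
      have "dist (g l i x) (g m i x) < \<epsilon>" if "l \<ge> k" "m \<ge> k" for l m
      proof -
        have "\<bar>g l i x - g k i x\<bar> \<le> 3/8 * \<delta> k" "\<bar>g m i x - g k i x\<bar> \<le> 3/8 * \<delta> k"
          using drift[OF ix, of k "l-k"] drift[OF ix, of k "m-k"] that by auto
        then show ?thesis using k \<delta>[of k] unfolding dist_real_def by linarith
      qed
      then show "\<exists>K. \<forall>l\<ge>K. \<forall>m\<ge>K. dist (g l i x) (g m i x) < \<epsilon>" by blast
    qed
    then show ?thesis unfolding f_def by (simp add: Cauchy_convergent_iff convergent_LIMSEQ_iff)
  qed
  have f_close: "\<bar>f i x - g k i x\<bar> \<le> 3/8 * \<delta> k" if ix: "i < 2*n+3" "x \<in> M" for i x k
  proof (rule tendsto_upperbound)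
    show "((\<lambda>l. \<bar>g l i x - g k i x\<bar>) \<longlongrightarrow> \<bar>f i x - g k i x\<bar>) sequentially"
      using lim[OF ix] by (intro tendsto_intros)
    show "\<forall>\<^sub>F l in sequentially. \<bar>g l i x - g k i x\<bar> \<le> 3/8 * \<delta> k"
      using drift[OF ix, of k] by (intro eventually_sequentiallyI[of k]) (metis le_add_diff_inverse)
  qed auto
  show thesis
  proof
    show "continuous_map mtopology euclideanreal (f i)" if i: "i < 2*n+3" for i
    proof -
      have "continuous_map mtopology Met_TC.mtopology (f i)"
      \<comment> \<open>The rate \<open>(1/4)^k\<close> does not depend on the point, so convergence
        is uniform and continuity passes to the limit.\<close>
      proof (rule Met_TC.continuous_map_uniform_limit[of _ "\<lambda>k. g k i" sequentially])
        fix \<epsilon> :: real assume "\<epsilon> > 0"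
        obtain k where k: "(1/4::real)^k < \<epsilon>" using real_arch_pow_inv[OF \<open>\<epsilon> > 0\<close>, of "1/4"] by auto
        have "dist (g l i x) (f i x) < \<epsilon>" if "l \<ge> k" "x \<in> M" for l x
        proof -
          have "(1/4::real)^l \<le> (1/4)^k" using that by (intro power_decreasing) auto
          then show ?thesis using f_close[OF i that(2), of l] \<delta>[of l] k unfolding dist_real_def by linarith
        qed
        then show "\<forall>\<^sub>F l in sequentially. \<forall>x\<in>topspace mtopology. f i x \<in> UNIV \<and> dist (g l i x) (f i x) < \<epsilon>"
          by (intro eventually_sequentiallyI[of k]) auto
      qed (use cont[OF i] in auto)
      then show ?thesis by simp
    qed
    show "\<exists>i<2*n+3. f i x \<noteq> f i y" if xy: "x \<in> M" "y \<in> M" "x \<noteq> y" for x y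
    proof -
      obtain k where "1 / real (Suc k) < d x y"
        using xy mdist_pos_less reals_Archimedean by (metis inverse_eq_divide)
      \<comment> \<open>At stage \<open>k\<close> the two values differ by more than
        \<open>\<delta> k\<close>; in the limit each moves by at most
        \<open>3/8 * \<delta> k\<close>, so they stay distinct.\<close>
      then obtain i where i: "i < 2*n+3" "\<delta> k < \<bar>g k i x - g k i y\<bar>" using sep[OF xy(1,2), of k] by force
      then show ?thesis
        using f_close[OF i(1) xy(1), of k] f_close[OF i(1) xy(2), of k] \<delta>(1)[of k]
        by (intro exI[of _ i] conjI notI) linarith+
    qed
  qed
qed

section \<open>Density in the compact finite-dimensional case, and the equivalence\<close>

lemma compact_continuous_bounded:
  assumes "compact_space X" "continuous_map X euclideanreal f"
  obtains B where "\<And>x. x \<in> topspace X \<Longrightarrow> \<bar>f x\<bar> \<le> B"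
proof -
  have "compactin euclideanreal (f ` topspace X)"
    using assms by (intro image_compactin) (auto simp: compact_space_def)
  then have "bounded (f ` topspace X)" by (simp add: compact_imp_bounded)
  then show ?thesis using that by (auto simp: bounded_iff)
qed

lemma doubling_metrics_dense:
  assumes comp: "compact_space X" and dim: "covering_dim_le X n"
    and d: "d \<in> met_space X" and "\<epsilon> > 0"
  shows "\<exists>e\<in>doubling_metrics X. metD X d e < ereal \<epsilon>"
proof -
  note D = met_spaceD[OF d]
  interpret Metric_space "topspace X" d by fact
  define \<eta> where "\<eta> = \<epsilon> / 4"
  have \<eta>: "\<eta> > 0" "2 * \<eta> < \<epsilon>" using \<open>\<epsilon> > 0\<close> by (auto simp: \<eta>_def)
  obtain A where A: "finite A" "A \<subseteq> topspace X" "\<And>x. x \<in> topspace X \<Longrightarrow> \<exists>a\<in>A. d a x < \<eta>"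
    using finite_separated_net[of \<eta>] comp \<eta>(1) unfolding D(2) by metis
  obtain f :: "nat \<Rightarrow> 'a \<Rightarrow> real" where f:
    "\<And>i. i < 2*n+3 \<Longrightarrow> continuous_map X euclideanreal (f i)"
    "\<And>x y. \<lbrakk>x \<in> topspace X; y \<in> topspace X; x \<noteq> y\<rbrakk> \<Longrightarrow> \<exists>i<2*n+3. f i x \<noteq> f i y"
    using finite_dimensional_separating_functions[of n] comp dim unfolding D(2) by metis
  have "\<forall>i\<in>{..<2*n+3}. \<exists>B. \<forall>x\<in>topspace X. \<bar>f i x\<bar> \<le> B"
    using compact_continuous_bounded[OF comp f(1)] by (metis lessThan_iff)
  then obtain b where b: "\<And>i x. \<lbrakk>i < 2*n+3; x \<in> topspace X\<rbrakk> \<Longrightarrow> \<bar>f i x\<bar> \<le> b i" by (metis lessThan_iff)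
  define B where "B = 1 + (\<Sum>i<2*n+3. \<bar>b i\<bar>)"
  have B: "B > 0" by (auto simp: B_def intro!: add_pos_nonneg sum_nonneg)
  have bB: "\<bar>f i x\<bar> \<le> B" if "i < 2*n+3" "x \<in> topspace X" for i x
  proof -
    have "\<bar>b i\<bar> \<le> (\<Sum>i<2*n+3. \<bar>b i\<bar>)" using that by (intro member_le_sum) auto
    then show ?thesis using b[OF that] by (simp add: B_def)
  qed
  \<comment> \<open>Each \<open>f i\<close> varies by at most \<open>2 * B\<close>, so after scaling
    by \<open>t\<close> it varies by at most \<open>\<eta>\<close>. The 1 in \<open>B\<close> keeps
    the denominator positive.\<close>
  define t where "t = \<eta> / (2 * B)"
  have t: "t > 0" using \<eta> B by (simp add: t_def)
  define I where "I = A <+> {..<2*n+3}"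
  define F where "F = case_sum d (\<lambda>i x. t * f i x)"
  define e where "e = (\<lambda>x y. if x \<in> topspace X \<and> y \<in> topspace X then sup_dist I F x y else 0)"
  have I: "finite I" using A by (simp add: I_def)
  have "e \<in> doubling_metrics X"
    unfolding e_def
  proof (rule sup_dist_doubling_metric[OF comp I])
    show "continuous_map X euclideanreal (F i)" if "i \<in> I" for i
      using that continuous_map_met_space[OF d] A(2) f(1)
      by (auto simp: I_def F_def intro!: continuous_map_real_mult_left)
    show "\<exists>i\<in>I. F i x \<noteq> F i y" if xy: "x \<in> topspace X" "y \<in> topspace X" "x \<noteq> y" for x y
    proof -
      obtain i where "i < 2*n+3" "f i x \<noteq> f i y" using f(2)[OF xy] by blast
      then show ?thesis using t by (intro bexI[of _ "Inr i"]) (auto simp: I_def F_def)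
    qed
  qed
  moreover have "\<bar>d x y - e x y\<bar> \<le> 2 * \<eta>" if xy: "x \<in> topspace X" "y \<in> topspace X" for x y
  proof -
    \<comment> \<open>Lower estimate: \<open>d x y\<close> is at most
      \<open>2 * d a x + \<bar>d a x - d a y\<bar>\<close>, and the net point \<open>a\<close> makes
      the first term less than \<open>2 * \<eta>\<close>. Upper estimate: net coordinates never
      exceed \<open>d x y\<close>, and the others never exceed \<open>\<eta>\<close>.\<close>
    obtain a where a: "a \<in> A" "d a x < \<eta>" using A(3)[OF xy(1)] by blast
    have "\<bar>d a x - d a y\<bar> \<le> sup_dist I F x y"
      using sup_dist_upper[OF I, of "Inl a" F x y] a by (auto simp: I_def F_def)
    moreover have "d x y \<le> d a x + d a y" using a A xy by (intro triangle'') auto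
    moreover have "sup_dist I F x y \<le> d x y + \<eta>"
      unfolding sup_dist_le_iff[OF I]
    proof (intro conjI ballI)
      fix i assume "i \<in> I"
      then consider (net) a where "a \<in> A" "i = Inl a" | (sep) j where "j < 2*n+3" "i = Inr j"
        by (auto simp: I_def)
      then show "\<bar>F i x - F i y\<bar> \<le> d x y + \<eta>"
      proof cases
        case net
        then show ?thesis using mdist_reverse_triangle[of x a y] A(2) xy \<eta> by (auto simp: F_def commute)
      next
        case sep
        have "\<bar>f j x - f j y\<bar> \<le> 2 * B" using bB[OF sep(1) xy(1)] bB[OF sep(1) xy(2)] by linarith
        then have "t * \<bar>f j x - f j y\<bar> \<le> t * (2 * B)" using t by (intro mult_left_mono) auto
        then have "t * \<bar>f j x - f j y\<bar> \<le> \<eta>" using B by (simp add: t_def)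
        moreover have "\<bar>F i x - F i y\<bar> = t * \<bar>f j x - f j y\<bar>"
          using t sep by (simp add: F_def abs_mult right_diff_distrib[symmetric])
        ultimately show ?thesis using nonneg[of x y] by linarith
      qed
    qed (use \<eta> in auto)
    ultimately show ?thesis using a(2) xy by (auto simp: e_def)
  qed
  ultimately show ?thesis using \<eta>(2) by (auto simp: metD_less_iff)
qed

theorem theorem1p1:
  fixes X :: "'a topology"
  assumes "metrizable_space X"
  shows "(finite_dimensional X \<and> compact_space X) \<longleftrightarrow>
         (fsigma_in (met_topology X) (doubling_metrics X) \<and>
          (met_topology X) closure_of (doubling_metrics X) = topspace (met_topology X))"
proof -
  have dense_iff: "(met_topology X) closure_of (doubling_metrics X) = topspace (met_topology X) \<longleftrightarrow>
      (\<forall>d\<in>met_space X. \<forall>\<epsilon>>0. \<exists>e\<in>doubling_metrics X. metD X d e < ereal \<epsilon>)"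
    by (rule metD_dense_iff) (auto simp: doubling_metrics_def)
  have "finite_dimensional X \<and> compact_space X"
    if dense: "\<forall>d\<in>met_space X. \<forall>\<epsilon>>0. \<exists>e\<in>doubling_metrics X. metD X d e < ereal \<epsilon>"
  proof
    show comp: "compact_space X"
    proof (rule ccontr)
      assume "\<not> compact_space X"
      then obtain d where "d \<in> met_space X"
        "\<And>e. \<lbrakk>e \<in> met_space X; metD X d e < ereal (1/2)\<rbrakk> \<Longrightarrow> \<not> doubling (topspace X) e"
        using noncompact_imp_not_doubling_near[OF assms] by metis
      then show False using dense[rule_format, of d "1/2"] by (auto simp: doubling_metrics_def)
    qed
    \<comment> \<open>Density around any one metric, with an arbitrary radius, supplies a doubling
      metric generating \<open>X\<close>.\<close>
    obtain d where "d \<in> met_space X" using met_space_nonempty[OF assms] .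
    then obtain e where e: "e \<in> met_space X" "doubling (topspace X) e"
      using dense[rule_format, of d 1] by (auto simp: doubling_metrics_def)
    show "finite_dimensional X"
      using Metric_space.doubling_compact_imp_finite_dimensional[OF met_spaceD(1)[OF e(1)]] comp e
        met_spaceD(2)[OF e(1)] by simp
  qed
  \<comment> \<open>The F_\<sigma> half comes from \<open>fsigma_in_doubling_metrics\<close>, and
    \<open>doubling_metrics_dense\<close> gives density for the remaining direction.\<close>
  then show ?thesis
    unfolding dense_iff finite_dimensional_def
    using fsigma_in_doubling_metrics doubling_metrics_dense by blast
qed

end
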